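(* Let $0<\lambda\le\Lambda$ and let $g:\mathbb{R}\to\mathbb{R}$ satisfy: (g1) $g$ is locally Lipschitz; (g2) $g$ is odd; (g3) there exists $\alpha\in(0,+\infty]$ such that $g$ is positive on $(0,\alpha)$ and negative on $(\alpha,+\infty)$. For any $\xi\in\mathbb{R}$ there exists a solution $u_\xi\in C^2([0,R_\xi))$ of the Cauchy problem $$\mathcal{M}^-_{\lambda,\Lambda}(u'')+g(u)=0,\qquad u(0)=\xi,\qquad u'(0)=0,$$ where $R_\xi\in(0,+\infty]$ is such that $[0,R_\xi)$ is the maximal interval where $u_\xi$ is defined. Moreover: (i) if $|\xi|=\alpha\in\mathbb{R}$ or $\xi=0$, then $u_\xi\equiv\xi$; (ii) if $\alpha\in\mathbb{R}$ and $|\xi|>\alpha$, then $|u_\xi|$ strictly increases to $+\infty$ on $[0,R_\xi)$; (iii) if $0<\xi<\alpha$, then $R_\xi=+\infty$ and $u_\xi$ is oscillating and periodic with $\|u_\xi\|_{L^\infty(\mathbb{R}_+)}=\xi$; (iv) if $-\alpha<\xi<0$, then: (a) if $\Lambda G(\xi)<\lambda G(\alpha)$, then $R_\xi=+\infty$ and $u_\xi$ is oscillating and periodic with $\|u_\xi\|_{L^\infty(\mathbb{R}_+)}=u_\xi(r_2)<\alpha$, where $r_2$ is the first maximizer of $u_\xi$; (b) if $\Lambda G(\xi)=\lambda G(\alpha)$, then $R_\xi=+\infty$ and $-\alpha<u_\xi<\alpha$ in $\mathbb{R}_+$; moreover $u_\xi$ is increasing in $\mathbb{R}_+$ and $\lim_{r\to+\infty}u_\xi(r)=\alpha$;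 (c) if $\Lambda G(\xi)>\lambda G(\alpha)$, then $u_\xi$ increases to $+\infty$ on $[0,R_\xi)$.
   Context: In dimension one the Pucci operator is $\mathcal{M}^-_{\lambda,\Lambda}(u'')=\lambda u''$ if $u''\ge0$ and $\mathcal{M}^-_{\lambda,\Lambda}(u'')=\Lambda u''$ if $u''<0$. Notation: $G(t)=\int_0^t g(s)\,ds$; if $\alpha=+\infty$, $G(\alpha)$ means $\lim_{t\to+\infty}G(t)\in(0,+\infty]$. $\mathbb{R}_+=[0,+\infty)$. A solution is oscillating if it has an unbounded sequence of zeros. When $\alpha=+\infty$ the condition in (g3) on $(\alpha,+\infty)$ is void. *)

theory Defs
  imports "HOL-Analysis.Analysis" "HOL-Probability.Essential_Supremum"
begin

definition pucci_minus :: "real \<Rightarrow> real \<Rightarrow> real \<Rightarrow> real" where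
  "pucci_minus lam Lam m = (if m \<ge> 0 then lam * m else Lam * m)"

text \<open>The oriented integral of \<open>g\<close> from \<open>0\<close> to \<open>t\<close>, for \<open>t\<close> of either sign.\<close>

definition primitive :: "(real \<Rightarrow> real) \<Rightarrow> real \<Rightarrow> real" where
  "primitive g t = (LBINT s=ereal 0..ereal t. g s)"

text \<open>The value at \<open>\<infinity>\<close> is a limit in \<^typ>\<open>ereal\<close>, hence possibly \<open>\<infinity>\<close>; an improper integral
  would silently be \<open>0\<close> in the divergent case.\<close>

definition primitive_at :: "(real \<Rightarrow> real) \<Rightarrow> ereal \<Rightarrow> ereal" where
  "primitive_at g a =
     (if a = \<infinity> then Lim at_top (\<lambda>t::real. ereal (primitive g t))
      else ereal (primitive g (real_of_ereal a)))"

definition half_open_ivl :: "ereal \<Rightarrow> real set" where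
  "half_open_ivl R = {r. 0 \<le> r \<and> ereal r < R}"

text \<open>A solution on \<open>[0,R)\<close>, of class \<open>C\<^sup>2\<close> up to \<open>0\<close>: derivatives are taken within the interval,
  so they are one-sided at \<open>0\<close>. Values of \<open>u\<close> outside the interval are irrelevant.\<close>

definition is_solution ::
  "real \<Rightarrow> real \<Rightarrow> (real \<Rightarrow> real) \<Rightarrow> real \<Rightarrow> ereal \<Rightarrow> (real \<Rightarrow> real) \<Rightarrow> bool" where
  "is_solution lam Lam g \<xi> R u \<longleftrightarrow>
     0 < R \<and>
     (\<exists>u' u''.
        (\<forall>r\<in>half_open_ivl R. (u has_real_derivative u' r) (at r within half_open_ivl R)) \<and>
        (\<forall>r\<in>half_open_ivl R. (u' has_real_derivative u'' r) (at r within half_open_ivl R)) \<and>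
        continuous_on (half_open_ivl R) u'' \<and>
        (\<forall>r\<in>half_open_ivl R. pucci_minus lam Lam (u'' r) + g (u r) = 0) \<and>
        u 0 = \<xi> \<and> u' 0 = 0)"

definition is_maximal_solution ::
  "real \<Rightarrow> real \<Rightarrow> (real \<Rightarrow> real) \<Rightarrow> real \<Rightarrow> ereal \<Rightarrow> (real \<Rightarrow> real) \<Rightarrow> bool" where
  "is_maximal_solution lam Lam g \<xi> R u \<longleftrightarrow>
     is_solution lam Lam g \<xi> R u \<and>
     \<not> (\<exists>R' v. R < R' \<and> is_solution lam Lam g \<xi> R' v \<and> (\<forall>r\<in>half_open_ivl R. v r = u r))"

text \<open>The following notions concern functions on \<open>[0,\<infinity>)\<close>.\<close>

definition oscillating :: "(real \<Rightarrow> real) \<Rightarrow> bool" where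
  "oscillating u \<longleftrightarrow>
     (\<exists>z::nat \<Rightarrow> real. (\<forall>n. 0 \<le> z n \<and> u (z n) = 0) \<and> \<not> bounded (range z))"

definition periodic :: "(real \<Rightarrow> real) \<Rightarrow> bool" where
  "periodic u \<longleftrightarrow> (\<exists>T>0. \<forall>r\<ge>0. u (r + T) = u r)"

definition Linf_norm :: "(real \<Rightarrow> real) \<Rightarrow> ereal" where
  "Linf_norm u = esssup (lebesgue_on {0..}) (\<lambda>r. ereal \<bar>u r\<bar>)"

definition first_maximizer :: "(real \<Rightarrow> real) \<Rightarrow> real \<Rightarrow> bool" where
  "first_maximizer u r \<longleftrightarrow>
     is_arg_max u (\<lambda>s. 0 \<le> s) r \<and> (\<forall>s. is_arg_max u (\<lambda>s. 0 \<le> s) s \<longrightarrow> r \<le> s)"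

text \<open>Convergence as \<open>r\<close> tends to \<open>R\<close> from the left is expressed through \<^term>\<open>at_left R\<close> on
  \<^typ>\<open>ereal\<close>, which also covers \<open>R = \<infinity>\<close>.\<close>

definition strictly_increases_to_infinity :: "ereal \<Rightarrow> (real \<Rightarrow> real) \<Rightarrow> bool" where
  "strictly_increases_to_infinity R f \<longleftrightarrow>
     strict_mono_on (half_open_ivl R) f \<and> filterlim (f \<circ> real_of_ereal) at_top (at_left R)"

end

theory Submission
  imports Defs
begin

text \<open>
The Pucci operator is invertible in \<open>u''\<close>, so the equation is Newton's equation \<open>u'' = F(u)\<close>, where \<open>F\<close> is
\<open>- g / \<lambda>\<close> or \<open>- g / \<Lambda>\<close> according to the sign of \<open>g\<close>. With \<open>\<Psi>' = F\<close>, a solution starting at rest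
conserves energy: \<open>u'\<^sup>2 = 2 (\<Psi>(u) - \<Psi>(\<xi>))\<close>. As long as the right-hand side is positive, the time needed
to reach a position is the integral of the reciprocal of the speed, and the solution is the inverse
function of this travel time (locale \<open>rising_orbit\<close>). So solutions are built by quadrature, without a
general existence theorem for differential equations, and their monotonicity and limits come with the construction.
The integrand is singular at the start, but integrable because the force does not vanish there
(\<open>travel_time_exists\<close>).

What happens at the end \<open>\<beta>\<close> of the orbit decides the case. If the energy level is met at a point \<open>b\<close> where
the force points back, \<open>b\<close> is reached in finite time (\<open>lifetime_finite\<close>), and reflecting the
orbit in time gives a periodic solution (locale \<open>rebounding_orbit\<close>). If it is met at an equilibrium, the
Lipschitz condition makes the travel time infinite (\<open>lifetime_infinite_if_equilibrium\<close>), and the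
orbit creeps towards it. If it is never met, the orbit goes to infinity, in finite or infinite time.
Each solution is global or blows up, hence is maximal (\<open>maximal_if_blow_up\<close>).

For a start at \<open>\<xi>\<close> in \<open>(- \<alpha>, 0)\<close>, normalise \<open>\<Psi>(0) = 0\<close>: then \<open>\<Psi> = - G / \<lambda>\<close> on \<open>(- \<alpha>, 0)\<close> and
\<open>\<Psi> = - G / \<Lambda>\<close> on \<open>(0, \<alpha>)\<close>. So the energy level is met at the point \<open>b > 0\<close> with
\<open>\<lambda> G(b) = \<Lambda> G(\<xi>)\<close>, and comparing \<open>\<Lambda> G(\<xi>)\<close> with \<open>\<lambda> G(\<alpha>)\<close> separates the three cases.
A start at \<open>\<xi> > 0\<close> inside the well, or at \<open>\<xi> < - \<alpha>\<close>, is reduced to these arguments by \<open>u \<mapsto> - u\<close>, which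
exchanges \<open>\<lambda>\<close> and \<open>\<Lambda>\<close>. Inside the well \<open>\<lambda> G(\<xi>) < \<Lambda> G(\<alpha>)\<close> then always holds, and the solution is
periodic.
\<close>

section \<open>Newtonian equations\<close>

text \<open>A turning point is where the implicit formula for an orbit degenerates. There the derivative is
recovered as the limit of the derivatives at nearby points, by l'Hopital's rule.\<close>

lemma DERIV_at_right_from_limit:
  fixes f k :: "real \<Rightarrow> real"
  assumes "(f \<longlongrightarrow> f a) (at_right a)" and "(k \<longlongrightarrow> k a) (at_right a)"
    and "eventually (\<lambda>x. (f has_real_derivative k x) (at x)) (at_right a)"
  shows "(f has_real_derivative k a) (at a within {a..})"
proof -
  have "((\<lambda>x. (f x - f a) / (x - a)) \<longlongrightarrow> k a) (at_right a)"
  proof (rule lhopital_right[where f' = k and g' = "\<lambda>_. 1"])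
    show "((\<lambda>x. f x - f a) \<longlongrightarrow> 0) (at_right a)"
      using assms(1) by (simp add: LIM_zero)
    show "((\<lambda>x. x - a) \<longlongrightarrow> 0) (at_right a)"
      by (intro LIM_zero tendsto_ident_at)
    show "eventually (\<lambda>x. x - a \<noteq> 0) (at_right a)"
      by (simp add: eventually_at_filter)
    show "eventually (\<lambda>x. ((\<lambda>x. f x - f a) has_real_derivative k x) (at x)) (at_right a)"
      using assms(3) by eventually_elim (auto intro!: derivative_eq_intros)
    show "eventually (\<lambda>x. ((\<lambda>x. x - a) has_real_derivative 1) (at x)) (at_right a)"
      by (auto intro!: derivative_eq_intros always_eventually)
  qed (use assms(2) in auto)
  then show ?thesis
    by (simp add: has_field_derivative_iff at_within_Ici_at_right)
qed

lemma DERIV_from_limit: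
  fixes f k :: "real \<Rightarrow> real"
  assumes "isCont f a" and "isCont k a"
    and "eventually (\<lambda>x. (f has_real_derivative k x) (at x)) (at a)"
  shows "(f has_real_derivative k a) (at a)"
proof -
  have "((\<lambda>x. (f x - f a) / (x - a)) \<longlongrightarrow> k a) (at a)"
  proof (rule lhopital[where f' = k and g' = "\<lambda>_. 1"])
    show "((\<lambda>x. f x - f a) \<longlongrightarrow> 0) (at a)"
      using assms(1) by (simp add: LIM_zero isCont_def)
    show "((\<lambda>x. x - a) \<longlongrightarrow> 0) (at a)"
      by (intro LIM_zero tendsto_ident_at)
    show "eventually (\<lambda>x. x - a \<noteq> 0) (at a)"
      by (simp add: eventually_at_filter)
    show "eventually (\<lambda>x. ((\<lambda>x. f x - f a) has_real_derivative k x) (at x)) (at a)"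
      using assms(3) by eventually_elim (auto intro!: derivative_eq_intros)
    show "eventually (\<lambda>x. ((\<lambda>x. x - a) has_real_derivative 1) (at x)) (at a)"
      by (auto intro!: derivative_eq_intros always_eventually)
  qed (use assms(2) in \<open>auto simp: isCont_def\<close>)
  then show ?thesis
    by (simp add: has_field_derivative_iff)
qed

text \<open>The problem \<open>u'' = F(u)\<close>, \<open>u(0) = \<xi>\<close>, \<open>u'(0) = 0\<close> on \<open>[0,R)\<close>; the function \<open>v\<close> is the
velocity.\<close>

definition newton_solution ::
  "(real \<Rightarrow> real) \<Rightarrow> real \<Rightarrow> ereal \<Rightarrow> (real \<Rightarrow> real) \<Rightarrow> bool" where
  "newton_solution F \<xi> R u \<longleftrightarrow> 0 < R \<and> u 0 = \<xi> \<and>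
     (\<exists>v. v 0 = 0 \<and>
        (\<forall>r\<in>half_open_ivl R. (u has_real_derivative v r) (at r within half_open_ivl R)) \<and>
        (\<forall>r\<in>half_open_ivl R. (v has_real_derivative F (u r)) (at r within half_open_ivl R)))"

section \<open>Orbits leaving a turning point upwards\<close>

text \<open>A particle released at rest at \<open>\<xi>\<close> in the potential \<open>- \<Psi>\<close>. The force pushes it to the right, and
the energy level \<open>- \<Psi> \<xi>\<close> lies strictly above the potential up to \<open>\<beta>\<close>, so that it cannot turn
back before \<open>\<beta>\<close>. Conservation of energy gives its speed as a function of its position.\<close>

locale rising_orbit =
  fixes F \<Psi> :: "real \<Rightarrow> real" and \<xi> :: real and \<beta> :: ereal
  assumes F_cont: "continuous_on UNIV F"
    and \<Psi>_deriv: "\<And>x. (\<Psi> has_real_derivative F x) (at x)"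
    and start_below: "ereal \<xi> < \<beta>"
    and push: "0 < F \<xi>"
    and above: "\<And>x. \<xi> < x \<Longrightarrow> ereal x < \<beta> \<Longrightarrow> \<Psi> \<xi> < \<Psi> x"
begin

definition speed :: "real \<Rightarrow> real" where
  "speed x = sqrt (2 * (\<Psi> x - \<Psi> \<xi>))"

text \<open>The positions visited. The end \<open>\<beta>\<close> is left out: whether it is reached, and when, depends on the
force there.\<close>

definition range_of_orbit :: "real set" where
  "range_of_orbit = {x. \<xi> \<le> x \<and> ereal x < \<beta>}"

lemma in_rangeI: "\<xi> \<le> x \<Longrightarrow> ereal x < \<beta> \<Longrightarrow> x \<in> range_of_orbit"
  by (simp add: range_of_orbit_def)

lemma in_range_ge: "x \<in> range_of_orbit \<Longrightarrow> \<xi> \<le> x"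
  by (simp add: range_of_orbit_def)

lemma speed_start [simp]: "speed \<xi> = 0"
  by (simp add: speed_def)

lemma speed_pos: "\<xi> < x \<Longrightarrow> ereal x < \<beta> \<Longrightarrow> 0 < speed x"
  using above[of x] by (simp add: speed_def)

lemma speed_deriv:
  assumes "\<xi> < x" "ereal x < \<beta>"
  shows "(speed has_real_derivative F x / speed x) (at x)"
proof -
  have "0 < 2 * (\<Psi> x - \<Psi> \<xi>)" using above[OF assms] by simp
  moreover have "((\<lambda>x. 2 * (\<Psi> x - \<Psi> \<xi>)) has_real_derivative 2 * (F x - 0)) (at x)"
    by (intro DERIV_cmult DERIV_diff \<Psi>_deriv DERIV_const)
  ultimately have "((\<lambda>x. sqrt (2 * (\<Psi> x - \<Psi> \<xi>))) has_real_derivative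
      inverse (sqrt (2 * (\<Psi> x - \<Psi> \<xi>))) / 2 * (2 * (F x - 0))) (at x)"
    by (rule DERIV_chain2[where f = sqrt and g = "\<lambda>x. 2 * (\<Psi> x - \<Psi> \<xi>)", OF DERIV_real_sqrt])
  moreover have "inverse s / 2 * (2 * (a - 0)) = a / s" for a s :: real
    by (simp add: inverse_eq_divide)
  moreover have "speed = (\<lambda>x. sqrt (2 * (\<Psi> x - \<Psi> \<xi>)))" by (rule ext) (rule speed_def)
  ultimately show ?thesis by simp
qed

lemma isCont_speed: "isCont speed x"
  unfolding speed_def
  using DERIV_isCont[OF \<Psi>_deriv[of x]]
  by (intro continuous_real_sqrt continuous_mult continuous_diff continuous_const)

lemma below_in_range: "y \<in> range_of_orbit \<Longrightarrow> \<xi> \<le> x \<Longrightarrow> x \<le> y \<Longrightarrow> ereal x < \<beta>"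
  unfolding range_of_orbit_def by (auto intro: le_less_trans[of "ereal x" "ereal y" \<beta>])

text \<open>Near the start the force is bounded away from \<open>0\<close>; this is what makes the particle leave \<open>\<xi>\<close> in
finite time although its initial speed is \<open>0\<close>.\<close>

lemma push_near_start:
  obtains c x1 where "0 < c" "\<xi> < x1" "ereal x1 < \<beta>"
    "\<And>x. \<xi> \<le> x \<Longrightarrow> x \<le> x1 \<Longrightarrow> c \<le> F x"
proof -
  have "isCont F \<xi>" using F_cont by (simp add: continuous_on_eq_continuous_at)
  then have "eventually (\<lambda>x. F \<xi> / 2 < F x) (nhds \<xi>)"
    using push by (intro order_tendstoD(1)[of F "F \<xi>"])
      (auto simp: isCont_def tendsto_at_iff_tendsto_nhds)
  then obtain d where d: "d > 0" "\<And>x. dist x \<xi> < d \<Longrightarrow> F \<xi> / 2 < F x"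
    by (auto simp: eventually_nhds_metric)
  obtain b where b: "ereal \<xi> < ereal b" "ereal b < \<beta>"
    using ereal_dense2[OF start_below] by blast
  define x1 where "x1 = min b (\<xi> + d / 2)"
  have "ereal x1 < \<beta>" using b(2) le_less_trans[of "ereal x1" "ereal b" \<beta>] by (simp add: x1_def)
  moreover have "\<xi> < x1" using b d by (simp add: x1_def)
  moreover have "F \<xi> / 2 \<le> F x" if "\<xi> \<le> x" "x \<le> x1" for x
    using d(2)[of x] that d(1) by (auto simp: x1_def dist_real_def)
  ultimately show ?thesis using that[of "F \<xi> / 2" x1] push by auto
qed

text \<open>The travel time has derivative \<open>1 / speed\<close>, which is unbounded at \<open>\<xi>\<close>. Any antiderivative \<open>S\<close>
nevertheless has a finite limit there: \<open>speed\<close> has derivative \<open>F / speed\<close>, and \<open>F \<ge> c > 0\<close> near \<open>\<xi>\<close>,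
so \<open>S - speed / c\<close> decreases. Hence \<open>S\<close> exceeds its infimum \<open>l\<close> by at most \<open>speed / c\<close>, which
tends to \<open>0\<close>, and \<open>S - l\<close> extends continuously by \<open>0\<close>.\<close>

lemma travel_time_exists:
  "\<exists>T. T \<xi> = 0 \<and> continuous_on range_of_orbit T \<and>
     (\<forall>x. \<xi> < x \<longrightarrow> ereal x < \<beta> \<longrightarrow> (T has_real_derivative 1 / speed x) (at x))"
proof -
  have "\<exists>S. \<forall>x. ereal \<xi> < ereal x \<longrightarrow> ereal x < \<beta> \<longrightarrow>
          (S has_vector_derivative 1 / speed x) (at x)"
  proof (rule einterval_antiderivative[OF start_below])
    fix x assume "ereal \<xi> < ereal x" "ereal x < \<beta>"
    then show "isCont (\<lambda>x. 1 / speed x) x"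
      using speed_pos[of x] by (intro continuous_divide continuous_const isCont_speed) auto
  qed
  then obtain S where S: "\<And>x. \<xi> < x \<Longrightarrow> ereal x < \<beta> \<Longrightarrow>
      (S has_real_derivative 1 / speed x) (at x)"
    by (auto simp: has_real_derivative_iff_has_vector_derivative)
  obtain c x1 where c: "0 < c" and x1: "\<xi> < x1" "ereal x1 < \<beta>"
    and cF: "\<And>x. \<xi> \<le> x \<Longrightarrow> x \<le> x1 \<Longrightarrow> c \<le> F x"
    using push_near_start by blast
  have lt: "ereal x < \<beta>" if "x \<le> x1" for x
    using le_less_trans[of "ereal x" "ereal x1" \<beta>] that x1 by simp
  have mono: "S x \<le> S y" if "\<xi> < x" "x \<le> y" "y \<le> x1" for x y
  proof (rule DERIV_nonneg_imp_nondecreasing[OF that(2)])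
    fix z assume "x \<le> z" "z \<le> y"
    then have z: "\<xi> < z" "ereal z < \<beta>" using that lt by auto
    show "\<exists>D. (S has_real_derivative D) (at z) \<and> 0 \<le> D"
      using S[OF z] speed_pos[OF z] by (intro exI[of _ "1 / speed z"]) simp
  qed
  have comp: "S y - speed y / c \<le> S x - speed x / c" if "\<xi> < x" "x \<le> y" "y \<le> x1" for x y
  proof (rule DERIV_nonpos_imp_nonincreasing[OF that(2)])
    fix z assume z: "x \<le> z" "z \<le> y"
    then have z': "\<xi> < z" "ereal z < \<beta>" using that lt by auto
    have "1 / speed z - F z / speed z / c \<le> 0"
      using speed_pos[OF z'] cF[of z] z that c by (auto simp: field_simps)
    moreover have "((\<lambda>z. S z - speed z / c) has_real_derivative 1 / speed z - F z / speed z / c) (at z)"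
      by (intro DERIV_diff DERIV_cdivide S speed_deriv z')
    ultimately show "\<exists>D. ((\<lambda>z. S z - speed z / c) has_real_derivative D) (at z) \<and> D \<le> 0" by blast
  qed
  define l where "l = (INF x\<in>{\<xi><..x1}. S x)"
  have low: "S y - speed y / c \<le> S x" if "\<xi> < x" "x \<le> x1" "\<xi> < y" "y \<le> x1" for x y
  proof (cases "x \<le> y")
    case True
    have "0 \<le> speed x / c" using speed_pos[of x] lt[of x] c that by simp
    then show ?thesis using comp[of x y] that True by linarith
  next
    case False
    have "0 \<le> speed y / c" using speed_pos[of y] lt[of y] c that by simp
    then show ?thesis using mono[of y x] that False by linarith
  qed
  have bdd: "bdd_below (S ` {\<xi><..x1})"
    using low[of _ x1] x1 by (intro bdd_belowI2[where m = "S x1 - speed x1 / c"]) auto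
  have l1: "l \<le> S y" if "\<xi> < y" "y \<le> x1" for y
    unfolding l_def using that bdd by (intro cINF_lower) auto
  have l2: "S y - speed y / c \<le> l" if "\<xi> < y" "y \<le> x1" for y
    unfolding l_def using that x1 low[of _ y] by (intro cINF_greatest) auto
  have ev: "eventually (\<lambda>y. \<xi> < y \<and> y \<le> x1) (at_right \<xi>)"
    using x1(1) by (auto simp: eventually_at_right_field intro: exI[of _ x1])
  have "((\<lambda>y. S y - l) \<longlongrightarrow> 0) (at_right \<xi>)"
  proof (rule tendsto_sandwich)
    show "eventually (\<lambda>y. 0 \<le> S y - l) (at_right \<xi>)"
      using ev by eventually_elim (use l1 in auto)
    show "eventually (\<lambda>y. S y - l \<le> speed y / c) (at_right \<xi>)"
      using ev by eventually_elim (use l2 in \<open>simp add: algebra_simps\<close>)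
    have "(speed \<longlongrightarrow> 0) (at_right \<xi>)"
      using isCont_speed[of \<xi>] by (auto simp: isCont_def intro: tendsto_mono[OF at_le])
    then show "((\<lambda>y. speed y / c) \<longlongrightarrow> 0) (at_right \<xi>)"
      using c by (auto intro!: tendsto_eq_intros)
  qed simp
  define T where "T x = (if x = \<xi> then 0 else S x - l)" for x
  have TS: "eventually (\<lambda>y. T y = S y - l) (at x within A)" if "\<xi> \<le> x" for x A
  proof (cases "x = \<xi>")
    case True then show ?thesis by (auto simp: T_def eventually_at_filter)
  next
    case False
    then have "eventually (\<lambda>y. y \<in> {\<xi><..}) (nhds x)"
      using that by (intro eventually_nhds_in_open) auto
    then show ?thesis unfolding eventually_at_filter by eventually_elim (auto simp: T_def)
  qed
  have TD: "(T has_real_derivative 1 / speed x) (at x)" if "\<xi> < x" "ereal x < \<beta>" for x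
  proof -
    have "((\<lambda>x. S x - l) has_real_derivative 1 / speed x) (at x)"
      using S[OF that] by (auto intro!: derivative_eq_intros)
    then show ?thesis
    proof (rule has_field_derivative_transform_within_open)
      show "open {\<xi><..}" "x \<in> {\<xi><..}" using that by auto
    qed (auto simp: T_def)
  qed
  have "continuous (at x within range_of_orbit) T" if "x \<in> range_of_orbit" for x
  proof (cases "x = \<xi>")
    case True
    have "((\<lambda>y. S y - l) \<longlongrightarrow> 0) (at \<xi> within range_of_orbit)"
    proof (rule tendsto_within_subset[where S = "{\<xi>..}"])
      show "((\<lambda>y. S y - l) \<longlongrightarrow> 0) (at \<xi> within {\<xi>..})"
        using \<open>((\<lambda>y. S y - l) \<longlongrightarrow> 0) (at_right \<xi>)\<close> by (simp add: at_within_Ici_at_right)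
    qed (auto simp: range_of_orbit_def)
    moreover have "T \<xi> = 0" by (simp add: T_def)
    ultimately show ?thesis
      using True TS[of \<xi> range_of_orbit]
      by (simp add: continuous_within tendsto_cong)
  next
    case False
    then show ?thesis using TD[of x] that
      by (auto simp: range_of_orbit_def intro!: continuous_at_imp_continuous_within DERIV_isCont)
  qed
  then have "continuous_on range_of_orbit T" by (simp add: continuous_on_eq_continuous_within)
  moreover have "T \<xi> = 0" by (simp add: T_def)
  ultimately show ?thesis using TD by blast
qed

definition travel_time :: "real \<Rightarrow> real" where
  "travel_time = (SOME T. T \<xi> = 0 \<and> continuous_on range_of_orbit T \<and>
     (\<forall>x. \<xi> < x \<longrightarrow> ereal x < \<beta> \<longrightarrow> (T has_real_derivative 1 / speed x) (at x)))"

lemma travel_time_start [simp]: "travel_time \<xi> = 0"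
  and travel_time_cont: "continuous_on range_of_orbit travel_time"
  and travel_time_deriv: "\<xi> < x \<Longrightarrow> ereal x < \<beta> \<Longrightarrow>
    (travel_time has_real_derivative 1 / speed x) (at x)"
proof -
  have "travel_time \<xi> = 0 \<and> continuous_on range_of_orbit travel_time \<and>
     (\<forall>x. \<xi> < x \<longrightarrow> ereal x < \<beta> \<longrightarrow> (travel_time has_real_derivative 1 / speed x) (at x))"
    unfolding travel_time_def by (rule someI_ex[OF travel_time_exists])
  then show "travel_time \<xi> = 0" "continuous_on range_of_orbit travel_time"
    "\<xi> < x \<Longrightarrow> ereal x < \<beta> \<Longrightarrow> (travel_time has_real_derivative 1 / speed x) (at x)"
    by blast+
qed

lemma start_in_range: "\<xi> \<in> range_of_orbit"
  using start_below by (simp add: range_of_orbit_def)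

lemma travel_time_less:
  assumes "x \<in> range_of_orbit" "y \<in> range_of_orbit" "x < y"
  shows "travel_time x < travel_time y"
proof (rule DERIV_pos_imp_increasing_open[OF assms(3)])
  fix z assume z: "x < z" "z < y"
  then have "\<xi> \<le> x" "\<xi> < z" using assms(1) by (simp_all add: range_of_orbit_def)
  moreover have "ereal z < \<beta>"
    using below_in_range[OF assms(2), of z] \<open>\<xi> < z\<close> z by simp
  ultimately have z': "\<xi> < z" "ereal z < \<beta>" by auto
  show "\<exists>D. (travel_time has_real_derivative D) (at z) \<and> 0 < D"
    using travel_time_deriv[OF z'] speed_pos[OF z'] by auto
next
  show "continuous_on {x..y} travel_time"
    using assms(1) below_in_range[OF assms(2)]
    by (intro continuous_on_subset[OF travel_time_cont]) (auto simp: range_of_orbit_def)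
qed

lemma travel_time_inj: "inj_on travel_time range_of_orbit"
proof (rule linorder_inj_onI')
  fix x y assume "x \<in> range_of_orbit" "y \<in> range_of_orbit" "x < y"
  from travel_time_less[OF this] show "travel_time x \<noteq> travel_time y" by simp
qed

definition lifetime :: ereal where
  "lifetime = (SUP x\<in>range_of_orbit. ereal (travel_time x))"

text \<open>The orbit inverts the travel time: at time \<open>r\<close> it is at the position that takes time \<open>r\<close> to reach.\<close>

definition orbit :: "real \<Rightarrow> real" where
  "orbit = the_inv_into range_of_orbit travel_time"

lemma range_no_max:
  assumes "x \<in> range_of_orbit" obtains y where "y \<in> range_of_orbit" "x < y"
proof -
  obtain y where "ereal x < ereal y" "ereal y < \<beta>"
    using assms ereal_dense2[of "ereal x" \<beta>] by (auto simp: range_of_orbit_def)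
  then show ?thesis using assms that[of y] by (auto simp: range_of_orbit_def)
qed

lemma travel_time_less_lifetime:
  assumes "x \<in> range_of_orbit"
  shows "ereal (travel_time x) < lifetime"
proof -
  obtain y where y: "y \<in> range_of_orbit" "x < y" using range_no_max[OF assms] by blast
  have "ereal (travel_time x) < ereal (travel_time y)"
    using travel_time_less[OF assms y] by simp
  also have "\<dots> \<le> lifetime" unfolding lifetime_def using y(1) by (rule SUP_upper)
  finally show ?thesis .
qed

lemma travel_time_nonneg: "x \<in> range_of_orbit \<Longrightarrow> 0 \<le> travel_time x"
  using travel_time_less[OF start_in_range, of x]
  by (cases "x = \<xi>") (auto simp: range_of_orbit_def)

lemma travel_time_image: "travel_time ` range_of_orbit = half_open_ivl lifetime"
proof (intro equalityI subsetI)
  fix r assume "r \<in> half_open_ivl lifetime"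
  then have r: "0 \<le> r" "ereal r < lifetime" by (auto simp: half_open_ivl_def)
  then obtain x where x: "x \<in> range_of_orbit" "r < travel_time x"
    unfolding lifetime_def less_SUP_iff by auto
  have "\<exists>y. \<xi> \<le> y \<and> y \<le> x \<and> travel_time y = r"
    using r x(2) range_of_orbit_def x(1) below_in_range[OF x(1)]
    by (intro IVT' continuous_on_subset[OF travel_time_cont]) (auto simp: range_of_orbit_def)
  then show "r \<in> travel_time ` range_of_orbit"
    using below_in_range[OF x(1)] by (auto simp: range_of_orbit_def)
qed (use travel_time_nonneg travel_time_less_lifetime in \<open>auto simp: half_open_ivl_def\<close>)

lemma lifetime_pos: "0 < lifetime"
  using travel_time_less_lifetime[OF start_in_range] by (simp add: zero_ereal_def)

lemma orbit_travel_time: "x \<in> range_of_orbit \<Longrightarrow> orbit (travel_time x) = x"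
  unfolding orbit_def using travel_time_inj by (rule the_inv_into_f_f)

lemma orbit_in_range: "r \<in> half_open_ivl lifetime \<Longrightarrow> orbit r \<in> range_of_orbit"
  and travel_time_orbit: "r \<in> half_open_ivl lifetime \<Longrightarrow> travel_time (orbit r) = r"
  using orbit_travel_time unfolding travel_time_image[symmetric] by auto

lemma orbit_start [simp]: "orbit 0 = \<xi>"
  using orbit_travel_time[OF start_in_range] by simp

lemma orbit_strict_mono: "strict_mono_on (half_open_ivl lifetime) orbit"
proof (rule strict_mono_onI)
  fix r s assume rs: "r \<in> half_open_ivl lifetime" "s \<in> half_open_ivl lifetime" "r < s"
  show "orbit r < orbit s"
  proof (rule ccontr)
    assume "\<not> orbit r < orbit s"
    then have "orbit s < orbit r \<or> orbit s = orbit r" by auto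
    then show False
      using travel_time_less[OF orbit_in_range[OF rs(2)] orbit_in_range[OF rs(1)]]
        travel_time_orbit[OF rs(1)] travel_time_orbit[OF rs(2)] rs(3) by auto
  qed
qed

text \<open>Every level below \<open>\<beta>\<close> is exceeded from some time on: the orbit tends to \<open>\<beta>\<close> at the end of its
lifetime, whether these are finite or not.\<close>

lemma orbit_above_late:
  assumes "ereal M < \<beta>"
  obtains t where "0 \<le> t" "ereal t < lifetime"
    "\<And>r. t < r \<Longrightarrow> ereal r < lifetime \<Longrightarrow> M < orbit r"
proof -
  obtain x where x: "x \<in> range_of_orbit" "M < x"
  proof -
    obtain x where "max (ereal \<xi>) (ereal M) < ereal x" "ereal x < \<beta>"
      using ereal_dense2[of "max (ereal \<xi>) (ereal M)" \<beta>] assms start_below by auto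
    then show ?thesis using that[of x] by (auto simp: range_of_orbit_def)
  qed
  have t: "0 \<le> travel_time x" "ereal (travel_time x) < lifetime"
    using travel_time_nonneg[OF x(1)] travel_time_less_lifetime[OF x(1)] by auto
  have "M < orbit r" if "travel_time x < r" "ereal r < lifetime" for r
  proof -
    have "orbit (travel_time x) < orbit r"
      using that t by (intro strict_mono_onD[OF orbit_strict_mono]) (auto simp: half_open_ivl_def)
    then show ?thesis using orbit_travel_time[OF x(1)] x(2) by simp
  qed
  with t that show ?thesis by blast
qed

lemma orbit_eventually_above:
  assumes "ereal M < \<beta>"
  shows "eventually (\<lambda>r. M < orbit (real_of_ereal r)) (at_left lifetime)"
proof -
  obtain t where t: "0 \<le> t" "ereal t < lifetime"
    "\<And>r. t < r \<Longrightarrow> ereal r < lifetime \<Longrightarrow> M < orbit r"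
    using orbit_above_late[OF assms] by blast
  have "eventually (\<lambda>r. ereal t < r \<and> r < lifetime) (at_left lifetime)"
    using t(2) by (auto simp: eventually_at_left)
  then show ?thesis
  proof eventually_elim
    case (elim r)
    then obtain s where "r = ereal s" by (cases r) auto
    with elim t(3)[of s] show ?case by simp
  qed
qed

lemma orbit_cont_upto:
  assumes "x \<in> range_of_orbit"
  shows "continuous_on {0..travel_time x} orbit"
proof -
  have sub: "{\<xi>..x} \<subseteq> range_of_orbit"
    using below_in_range[OF assms] by (auto simp: range_of_orbit_def)
  have "continuous_on (travel_time ` {\<xi>..x}) orbit"
    using sub orbit_travel_time
    by (intro continuous_on_inv continuous_on_subset[OF travel_time_cont]) auto
  moreover have "{0..travel_time x} \<subseteq> travel_time ` {\<xi>..x}"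
  proof
    fix r assume "r \<in> {0..travel_time x}"
    then have "\<exists>y. \<xi> \<le> y \<and> y \<le> x \<and> travel_time y = r"
      using assms by (intro IVT' continuous_on_subset[OF travel_time_cont sub])
        (auto simp: range_of_orbit_def)
    then show "r \<in> travel_time ` {\<xi>..x}" by auto
  qed
  ultimately show ?thesis by (rule continuous_on_subset)
qed

lemma orbit_deriv:
  assumes "0 < r" "ereal r < lifetime"
  shows "(orbit has_real_derivative speed (orbit r)) (at r)" "\<xi> < orbit r" "ereal (orbit r) < \<beta>"
proof -
  have r: "r \<in> half_open_ivl lifetime" "0 \<in> half_open_ivl lifetime"
    using assms lifetime_pos by (auto simp: half_open_ivl_def zero_ereal_def)
  show x: "\<xi> < orbit r" "ereal (orbit r) < \<beta>"
    using strict_mono_onD[OF orbit_strict_mono r(2,1) assms(1)] orbit_in_range[OF r(1)]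
    by (auto simp: range_of_orbit_def)
  obtain y where y: "y \<in> range_of_orbit" "orbit r < y"
    using range_no_max[OF orbit_in_range[OF r(1)]] by blast
  have ry: "r < travel_time y"
    using travel_time_less[OF orbit_in_range[OF r(1)] y] travel_time_orbit[OF r(1)] by simp
  have "continuous_on {0<..<travel_time y} orbit"
    using orbit_cont_upto[OF y(1)] by (rule continuous_on_subset) auto
  then have cont: "isCont orbit r"
    using ry assms by (simp add: continuous_on_eq_continuous_at)
  have "(orbit has_real_derivative inverse (1 / speed (orbit r))) (at r)"
  proof (rule DERIV_inverse_function[where f = travel_time and a = 0 and b = "travel_time y"])
    show "(travel_time has_real_derivative 1 / speed (orbit r)) (at (orbit r))"
      using travel_time_deriv x by blast
    show "travel_time (orbit s) = s" if "0 < s" "s < travel_time y" for s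
    proof -
      have "ereal s < lifetime"
        using that travel_time_less_lifetime[OF y(1)] less_trans[of "ereal s" "ereal (travel_time y)"] by simp
      then show ?thesis using that by (intro travel_time_orbit) (simp add: half_open_ivl_def)
    qed
  qed (use x speed_pos[OF x] assms ry cont in auto)
  then show "(orbit has_real_derivative speed (orbit r)) (at r)" by (simp add: inverse_eq_divide)
qed

lemma orbit_tendsto_start: "(orbit \<longlongrightarrow> \<xi>) (at_right 0)"
proof -
  obtain y where y: "y \<in> range_of_orbit" "\<xi> < y" using range_no_max[OF start_in_range] by blast
  have p: "0 < travel_time y" using travel_time_less[OF start_in_range y] by simp
  have "(orbit \<longlongrightarrow> orbit 0) (at 0 within {0..travel_time y})"
    using bspec[OF orbit_cont_upto[OF y(1), unfolded continuous_on_def], of 0] p by simp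
  then show ?thesis using p by (simp add: at_within_Icc_at_right)
qed

text \<open>The chain rule: the position changes at rate \<open>speed\<close>, and \<open>speed\<close> has derivative \<open>F / speed\<close> in the
position, so the factors \<open>speed\<close> cancel and the acceleration is \<open>F\<close>.\<close>

lemma orbit_speed_deriv:
  assumes "0 < r" "ereal r < lifetime"
  shows "((\<lambda>r. speed (orbit r)) has_real_derivative F (orbit r)) (at r)"
  using DERIV_chain2[OF speed_deriv[OF orbit_deriv(2,3)] orbit_deriv(1), OF assms assms assms]
    speed_pos[OF orbit_deriv(2,3)[OF assms]] by simp

text \<open>For positive times the derivatives are those of \<open>orbit_deriv\<close> and \<open>orbit_speed_deriv\<close>. At time \<open>0\<close>,
where the speed vanishes, both are obtained as limits.\<close>

lemma orbit_solves: "newton_solution F \<xi> lifetime orbit"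
proof -
  have sub: "half_open_ivl lifetime \<subseteq> {0..}" by (auto simp: half_open_ivl_def)
  obtain d where d: "0 < ereal d" "ereal d < lifetime" using ereal_dense2[OF lifetime_pos] by auto
  have ev: "eventually (\<lambda>r. 0 < r \<and> ereal r < lifetime) (at_right 0)"
    unfolding eventually_at_right_field
    using d less_trans[of "ereal _" "ereal d" lifetime] by (intro exI[of _ d]) auto
  have speed_lim: "((\<lambda>r. speed (orbit r)) \<longlongrightarrow> speed (orbit 0)) (at_right 0)"
    using orbit_tendsto_start isCont_tendsto_compose[OF isCont_speed] by force
  have F_lim: "((\<lambda>r. F (orbit r)) \<longlongrightarrow> F (orbit 0)) (at_right 0)"
    using orbit_tendsto_start F_cont isCont_tendsto_compose[of \<xi> F]
    by (force simp: continuous_on_eq_continuous_at)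
  have u0: "(orbit has_real_derivative speed (orbit 0)) (at 0 within {0..})"
    using ev orbit_tendsto_start speed_lim
    by (intro DERIV_at_right_from_limit[where k = "\<lambda>r. speed (orbit r)"])
      (auto elim!: eventually_mono intro: orbit_deriv)
  have v0: "((\<lambda>r. speed (orbit r)) has_real_derivative F (orbit 0)) (at 0 within {0..})"
    using ev F_lim speed_lim
    by (intro DERIV_at_right_from_limit[where k = "\<lambda>r. F (orbit r)"])
      (auto elim!: eventually_mono intro: orbit_speed_deriv)
  show ?thesis unfolding newton_solution_def
  proof (intro conjI exI[of _ "\<lambda>r. speed (orbit r)"] ballI)
    fix r assume r: "r \<in> half_open_ivl lifetime"
    show "(orbit has_real_derivative speed (orbit r)) (at r within half_open_ivl lifetime)"
      using r u0 DERIV_subset[OF _ sub] has_field_derivative_at_within[OF orbit_deriv(1), of r]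
      by (cases "r = 0") (auto simp: half_open_ivl_def)
    show "((\<lambda>r. speed (orbit r)) has_real_derivative F (orbit r)) (at r within half_open_ivl lifetime)"
      using r v0 DERIV_subset[OF _ sub] has_field_derivative_at_within[OF orbit_speed_deriv, of r]
      by (cases "r = 0") (auto simp: half_open_ivl_def)
  qed (auto simp: lifetime_pos)
qed

end

text \<open>Whether the lifetime is finite is read off from the travel time, by comparison with functions whose
derivative is known.\<close>

context rising_orbit
begin

lemma travel_time_growth:
  assumes "\<xi> < x" "x \<le> y" "ereal y < \<beta>"
    and D: "\<And>z. x \<le> z \<Longrightarrow> z \<le> y \<Longrightarrow> (f has_real_derivative f' z) (at z)"
    and le: "\<And>z. x \<le> z \<Longrightarrow> z \<le> y \<Longrightarrow> f' z \<le> 1 / speed z"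
  shows "f y - f x \<le> travel_time y - travel_time x"
proof -
  have "travel_time x - f x \<le> travel_time y - f y"
  proof (rule DERIV_nonneg_imp_nondecreasing[OF assms(2)])
    fix z assume z: "x \<le> z" "z \<le> y"
    have z': "\<xi> < z" "ereal z < \<beta>"
      using z assms(1,3) le_less_trans[of "ereal z" "ereal y" \<beta>] by simp_all
    have "((\<lambda>z. travel_time z - f z) has_real_derivative 1 / speed z - f' z) (at z)"
      by (intro DERIV_diff travel_time_deriv z' D z)
    then show "\<exists>d. ((\<lambda>z. travel_time z - f z) has_real_derivative d) (at z) \<and> 0 \<le> d"
      using le[OF z] by auto
  qed
  then show ?thesis by simp
qed

lemma lifetime_infinite:
  assumes "\<And>M. \<exists>x\<in>range_of_orbit. M \<le> travel_time x"
  shows "lifetime = \<infinity>"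
proof (rule ereal_top)
  fix M
  obtain x where "x \<in> range_of_orbit" "M \<le> travel_time x" using assms by blast
  then show "ereal M \<le> lifetime"
    using travel_time_less_lifetime[of x] by (meson ereal_less_eq(3) le_less_trans less_imp_le)
qed

lemma lifetime_infinite_if_speed_bounded:
  assumes "\<beta> = \<infinity>" and C: "\<And>x. \<xi> < x \<Longrightarrow> speed x \<le> C"
  shows "lifetime = \<infinity>"
proof (rule lifetime_infinite)
  fix M :: real
  have C0: "0 < C" using speed_pos[of "\<xi> + 1"] C[of "\<xi> + 1"] assms(1) by simp
  define x where "x = \<xi> + 1"
  define y where "y = x + C * \<bar>M\<bar>"
  have xy: "x \<le> y" "\<xi> < x" using C0 by (auto simp: x_def y_def)
  have "y / C - x / C \<le> travel_time y - travel_time x"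
  proof (rule travel_time_growth[where f' = "\<lambda>_. 1 / C"])
    show "1 / C \<le> 1 / speed z" if "x \<le> z" for z
      using that xy C[of z] speed_pos[of z] assms(1) by (auto intro!: divide_left_mono)
    show "((\<lambda>z. z / C) has_real_derivative 1 / C) (at z)" for z
      by (intro DERIV_cdivide DERIV_ident)
  qed (use xy assms(1) in auto)
  moreover have "y / C - x / C = \<bar>M\<bar>" using C0 by (simp add: y_def field_simps)
  moreover have "0 \<le> travel_time x"
    using xy assms(1) by (intro travel_time_nonneg in_rangeI) auto
  ultimately have "M \<le> travel_time y" by linarith
  then show "\<exists>x\<in>range_of_orbit. M \<le> travel_time x"
    using xy assms(1) by (intro bexI[of _ y] in_rangeI) auto
qed

text \<open>An equilibrium is not reached in finite time. A backward force of size at most \<open>L * (b - x)\<close> makes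
\<open>2 * (\<Psi> x - \<Psi> \<xi>)\<close> at most quadratic in \<open>b - x\<close>, so \<open>speed x \<le> C * (b - x)\<close>, and the travel time
grows at least like \<open>- ln (b - x) / C\<close>.\<close>

lemma lifetime_infinite_if_equilibrium:
  assumes b: "\<beta> = ereal b" "\<Psi> b = \<Psi> \<xi>" and x1: "\<xi> < x1" "x1 < b"
    and lip: "\<And>x. x1 \<le> x \<Longrightarrow> x \<le> b \<Longrightarrow> - L * (b - x) \<le> F x"
  shows "lifetime = \<infinity>"
proof (rule lifetime_infinite)
  fix M :: real
  define K where "K = max L 1"
  have K: "K \<ge> 1" "K \<ge> L" by (auto simp: K_def)
  have energy: "2 * (\<Psi> x - \<Psi> \<xi>) \<le> K * (b - x)\<^sup>2" if x: "x1 \<le> x" "x \<le> b" for x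
  proof -
    have "2 * \<Psi> x - K * (b - x)\<^sup>2 \<le> 2 * \<Psi> b - K * (b - b)\<^sup>2"
    proof (rule DERIV_nonneg_imp_nondecreasing[OF x(2)])
      fix z assume z: "x \<le> z" "z \<le> b"
      have "((\<lambda>z. 2 * \<Psi> z - K * (b - z)\<^sup>2) has_real_derivative 2 * F z + 2 * K * (b - z)) (at z)"
        by (rule derivative_eq_intros \<Psi>_deriv refl | simp add: algebra_simps)+
      moreover have "0 \<le> 2 * F z + 2 * K * (b - z)"
        using lip[of z] mult_right_mono[OF K(2), of "b - z"] z x by auto
      ultimately show "\<exists>D. ((\<lambda>z. 2 * \<Psi> z - K * (b - z)\<^sup>2) has_real_derivative D) (at z) \<and> 0 \<le> D"
        by blast
    qed
    then show ?thesis using b by simp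
  qed
  define C where "C = sqrt K"
  have C: "0 < C" using K by (simp add: C_def)
  have sp: "speed x \<le> C * (b - x)" if "x1 \<le> x" "x \<le> b" for x
  proof -
    have "speed x \<le> sqrt (K * (b - x)\<^sup>2)"
      unfolding speed_def using energy[OF that] by (rule real_sqrt_le_mono)
    then show ?thesis using that by (simp add: real_sqrt_mult C_def)
  qed
  \<comment> \<open>the position at which the logarithmic
    lower bound on the travel time from \<open>x1\<close> equals \<open>\<bar>M\<bar>\<close>\<close>
  define y where "y = b - (b - x1) * exp (- C * \<bar>M\<bar>)"
  have "exp (- C * \<bar>M\<bar>) \<le> 1" using C by simp
  then have "(b - x1) * exp (- C * \<bar>M\<bar>) \<le> b - x1" using x1 mult_left_mono[of _ 1 "b - x1"] by auto
  moreover have "0 < (b - x1) * exp (- C * \<bar>M\<bar>)" using x1 by simp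
  ultimately have y: "x1 \<le> y" "y < b" unfolding y_def by linarith+
  have "- ln (b - y) / C - - ln (b - x1) / C \<le> travel_time y - travel_time x1"
  proof (rule travel_time_growth[where f' = "\<lambda>z. 1 / (C * (b - z))"])
    fix z assume z: "x1 \<le> z" "z \<le> y"
    show "((\<lambda>z. - ln (b - z) / C) has_real_derivative 1 / (C * (b - z))) (at z)"
      using z y C by (auto intro!: derivative_eq_intros simp: field_simps)
    show "1 / (C * (b - z)) \<le> 1 / speed z"
      using z y x1 sp[of z] speed_pos[of z] b C by (intro divide_left_mono) auto
  qed (use x1 y b in auto)
  moreover have "ln (b - y) = ln (b - x1) - C * \<bar>M\<bar>"
    using x1 ln_mult[of "b - x1" "exp (- C * \<bar>M\<bar>)"] by (simp add: y_def)
  then have "- ln (b - y) / C - - ln (b - x1) / C = \<bar>M\<bar>"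
    using C by (simp add: field_simps)
  moreover have "0 \<le> travel_time x1"
    using x1 b by (intro travel_time_nonneg in_rangeI) auto
  ultimately have "M \<le> travel_time y" by linarith
  then show "\<exists>x\<in>range_of_orbit. M \<le> travel_time x"
    using x1 y b by (intro bexI[of _ y] in_rangeI) auto
qed

text \<open>A turning point is reached in finite time, for the reason that makes the travel time finite at the
start: near \<open>b\<close> the force is at most \<open>- c\<close>, so \<open>travel_time + speed / c\<close> decreases and bounds the
travel time.\<close>

lemma lifetime_finite:
  assumes b: "\<beta> = ereal b" and pull: "F b < 0"
  shows "lifetime < \<infinity>"
proof -
  have "isCont F b" using F_cont by (simp add: continuous_on_eq_continuous_at)
  then have "eventually (\<lambda>x. F x < F b / 2) (nhds b)"
    using pull by (intro order_tendstoD(2)[of F "F b"])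
      (auto simp: isCont_def tendsto_at_iff_tendsto_nhds)
  then obtain d where d: "d > 0" "\<And>x. dist x b < d \<Longrightarrow> F x < F b / 2"
    by (auto simp: eventually_nhds_metric)
  define c where "c = - F b / 2"
  have c: "0 < c" using pull by (simp add: c_def)
  define x1 where "x1 = max ((\<xi> + b) / 2) (b - d / 2)"
  have x1: "\<xi> < x1" "x1 < b" using start_below b d(1) by (simp_all add: x1_def max_def)
  have F: "F x \<le> - c" if "x1 \<le> x" "x < b" for x
    using d(2)[of x] d(1) that by (auto simp: x1_def c_def dist_real_def)
  have x1r: "x1 \<in> range_of_orbit" using x1 b by (intro in_rangeI) auto
  have bound: "travel_time x \<le> travel_time x1 + speed x1 / c" if "x \<in> range_of_orbit" for x
  proof (cases "x \<le> x1")
    case True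
    then have "travel_time x \<le> travel_time x1"
      using travel_time_less[OF that x1r] by (cases "x = x1") auto
    moreover have "0 \<le> speed x1 / c" using speed_pos[of x1] x1 b c by auto
    ultimately show ?thesis by linarith
  next
    case False
    then have x: "x1 \<le> x" "x < b" 
      using False below_in_range[OF that, of x] in_range_ge[OF that] b(1) by auto
    have "travel_time x + speed x / c \<le> travel_time x1 + speed x1 / c"
    proof (rule DERIV_nonpos_imp_nonincreasing[OF x(1)])
      fix z assume z: "x1 \<le> z" "z \<le> x"
      then have z': "\<xi> < z" "ereal z < \<beta>" using x x1 b by auto
      have "((\<lambda>z. travel_time z + speed z / c) has_real_derivative
              1 / speed z + F z / speed z / c) (at z)"
        by (intro DERIV_add DERIV_cdivide travel_time_deriv speed_deriv z')
      moreover have "1 / speed z + F z / speed z / c \<le> 0"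
        using F[of z] z x c speed_pos[OF z'] by (simp add: field_simps)
      ultimately show "\<exists>D. ((\<lambda>z. travel_time z + speed z / c) has_real_derivative D) (at z) \<and> D \<le> 0"
        by blast
    qed
    moreover have "0 \<le> speed x / c" using speed_pos[of x] x x1 b c by auto
    ultimately show ?thesis by linarith
  qed
  have "lifetime \<le> ereal (travel_time x1 + speed x1 / c)"
    unfolding lifetime_def using bound by (intro SUP_least) simp
  then show ?thesis by auto
qed

end

section \<open>Periodic orbits between two turning points\<close>

text \<open>The particle climbs to a point \<open>b\<close> at its initial energy level, where the force pushes it back. By
reversibility it returns along the same path, and the motion is periodic.\<close>

locale rebounding_orbit = rising_orbit F \<Psi> \<xi> "ereal b"
  for F \<Psi> :: "real \<Rightarrow> real" and \<xi> b :: real +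
  assumes pull: "F b < 0" and level: "\<Psi> b = \<Psi> \<xi>"
begin

definition half_period :: real where
  "half_period = real_of_ereal lifetime"

lemma lifetime_eq: "lifetime = ereal half_period" and half_period_pos: "0 < half_period"
proof -
  have "lifetime < \<infinity>" by (rule lifetime_finite[OF refl pull])
  with lifetime_pos show "lifetime = ereal half_period"
    unfolding half_period_def by (cases lifetime) auto
  with lifetime_pos show "0 < half_period" by (simp add: zero_ereal_def)
qed

text \<open>The triangle wave of period \<open>2 * half_period\<close> that rises from \<open>0\<close> to \<open>half_period\<close> with slope \<open>1\<close>
and falls back with slope \<open>- 1\<close>. Composing the rising half of the orbit with it reflects and repeats
that half.\<close>

definition phase :: "real \<Rightarrow> real" where
  "phase r = half_period / pi * arccos (cos (pi * r / half_period))"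

definition half_wave :: "real \<Rightarrow> real" where
  "half_wave s = (if s < half_period then orbit s else b)"

definition wave :: "real \<Rightarrow> real" where
  "wave r = half_wave (phase r)"

text \<open>The sine is positive while the orbit rises and negative while it falls.\<close>

definition wave_velocity :: "real \<Rightarrow> real" where
  "wave_velocity r = sgn (sin (pi * r / half_period)) * speed (wave r)"

lemma speed_top: "speed b = 0"
  using level by (simp add: speed_def)

lemma phase_bounds: "0 \<le> phase r" "phase r \<le> half_period"
  using half_period_pos arccos_ubound[of "cos (pi * r / half_period)"]
    arccos_lbound[of "cos (pi * r / half_period)"]
  by (auto simp: phase_def field_simps)

lemma phase_id: "0 \<le> r \<Longrightarrow> r \<le> half_period \<Longrightarrow> phase r = r"
  using half_period_pos arccos_cos[of "pi * r / half_period"] by (simp add: phase_def field_simps)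

lemma phase_interior:
  assumes "sin (pi * r / half_period) \<noteq> 0"
  shows "0 < phase r" "phase r < half_period"
    "(phase has_real_derivative sgn (sin (pi * r / half_period))) (at r)"
proof -
  define \<theta> where "\<theta> = pi * r / half_period"
  have s: "(sin \<theta>)\<^sup>2 > 0" using assms by (simp add: \<theta>_def)
  then have "(cos \<theta>)\<^sup>2 < 1" using sin_cos_squared_add[of \<theta>] by linarith
  then have c: "- 1 < cos \<theta>" "cos \<theta> < 1" by (auto simp: abs_square_less_1)
  show "0 < phase r" "phase r < half_period"
    using arccos_lt_bounded[OF c] half_period_pos by (auto simp: phase_def \<theta>_def field_simps)
  have root: "sqrt (1 - (cos \<theta>)\<^sup>2) = \<bar>sin \<theta>\<bar>"
    by (simp flip: sin_squared_eq)
  have "((\<lambda>r. cos (pi * r / half_period)) has_real_derivative - sin \<theta> * (pi / half_period)) (at r)"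
    using DERIV_chain2[OF DERIV_cos DERIV_cdivide[OF DERIV_cmult_Id], of pi half_period r]
    unfolding \<theta>_def .
  then have "((\<lambda>r. arccos (cos (pi * r / half_period))) has_real_derivative
      inverse (- sqrt (1 - (cos \<theta>)\<^sup>2)) * (- sin \<theta> * (pi / half_period))) (at r)"
    unfolding \<theta>_def
    by (rule DERIV_chain2[where f = arccos and g = "\<lambda>r. cos (pi * r / half_period)",
          OF DERIV_arccos[OF c[unfolded \<theta>_def]]])
  then have "((\<lambda>r. half_period / pi * arccos (cos (pi * r / half_period))) has_real_derivative
      half_period / pi * (inverse (- sqrt (1 - (cos \<theta>)\<^sup>2)) * (- sin \<theta> * (pi / half_period)))) (at r)"
    by (rule DERIV_cmult)
  moreover have "half_period / pi * (inverse (- sqrt (1 - (cos \<theta>)\<^sup>2)) * (- sin \<theta> * (pi / half_period)))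
      = sgn (sin \<theta>)"
    unfolding root using half_period_pos assms by (simp add: sgn_if field_simps \<theta>_def)
  ultimately show "(phase has_real_derivative sgn (sin (pi * r / half_period))) (at r)"
    unfolding phase_def \<theta>_def by simp
qed

lemma half_wave_le: "0 \<le> s \<Longrightarrow> \<xi> \<le> half_wave s" "0 \<le> s \<Longrightarrow> half_wave s \<le> b"
  using orbit_in_range[of s] start_below lifetime_eq
  by (auto simp: half_wave_def half_open_ivl_def range_of_orbit_def)

lemma half_wave_cont: "continuous_on {0..half_period} half_wave"
  unfolding continuous_on_def
proof
  fix s assume s: "s \<in> {0..half_period}"
  consider "s = half_period" | "s < half_period" using s by force
  then show "(half_wave \<longlongrightarrow> half_wave s) (at s within {0..half_period})"
  proof cases
    case 1
    have "(half_wave \<longlongrightarrow> b) (at half_period within {0..half_period})"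
    proof (rule order_tendstoI)
      fix M assume "M < b"
      then obtain t where t: "0 \<le> t" "ereal t < lifetime"
        "\<And>r. t < r \<Longrightarrow> ereal r < lifetime \<Longrightarrow> M < orbit r"
        using orbit_above_late[of M] by auto
      have "eventually (\<lambda>r. t < r) (at half_period within {0..half_period})"
        using t(2) lifetime_eq by (intro order_tendstoD(1)[OF tendsto_ident_at]) simp
      then show "eventually (\<lambda>r. M < half_wave r) (at half_period within {0..half_period})"
        by eventually_elim (use t(3) \<open>M < b\<close> lifetime_eq in \<open>auto simp: half_wave_def\<close>)
    next
      fix M assume "b < M"
      then show "eventually (\<lambda>r. half_wave r < M) (at half_period within {0..half_period})"
        using half_wave_le(2)
        by (auto simp: eventually_at_filter intro!: always_eventually intro: le_less_trans)
    qed
    then show ?thesis using 1 by (simp add: half_wave_def)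
  next
    case 2
    have sl: "s \<in> half_open_ivl lifetime" using 2 s lifetime_eq by (simp add: half_open_ivl_def)
    obtain v where "(orbit has_real_derivative v) (at s within half_open_ivl lifetime)"
      using orbit_solves sl unfolding newton_solution_def by blast
    then have "(orbit \<longlongrightarrow> orbit s) (at s within half_open_ivl lifetime)"
      using DERIV_continuous continuous_within by blast
    moreover have "at s within half_open_ivl lifetime = at s within {0..half_period}"
      using 2 by (intro at_within_nhd[where S = "{..<half_period}"])
        (auto simp: half_open_ivl_def lifetime_eq)
    moreover have "eventually (\<lambda>r. r < half_period) (at s within {0..half_period})"
      using 2 by (intro order_tendstoD(2)[OF tendsto_ident_at])
    then have "eventually (\<lambda>r. half_wave r = orbit r) (at s within {0..half_period})"
      by eventually_elim (simp add: half_wave_def)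
    ultimately show ?thesis using 2 by (simp add: half_wave_def tendsto_cong)
  qed
qed

lemma wave_cont: "continuous_on UNIV wave"
proof -
  have "continuous_on UNIV phase"
    unfolding phase_def using half_period_pos
    by (intro continuous_intros continuous_on_arccos) auto
  then show ?thesis
    unfolding wave_def using phase_bounds
    by (intro continuous_on_compose2[OF half_wave_cont]) auto
qed

lemma isCont_wave: "isCont wave r"
  using wave_cont by (simp add: continuous_on_eq_continuous_at)

lemma wave_bounds: "\<xi> \<le> wave r" "wave r \<le> b"
  using half_wave_le phase_bounds by (auto simp: wave_def)

lemma wave_start: "wave 0 = \<xi>"
  using half_period_pos phase_id[of 0] by (simp add: wave_def half_wave_def)

lemma wave_top: "wave half_period = b"
  using half_period_pos phase_id[of half_period] by (simp add: wave_def half_wave_def)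

lemma wave_before_top: "0 \<le> r \<Longrightarrow> r < half_period \<Longrightarrow> wave r < b"
  using phase_id[of r] orbit_in_range[of r] lifetime_eq
  by (simp add: wave_def half_wave_def half_open_ivl_def range_of_orbit_def)

lemma wave_periodic: "wave (r + 2 * half_period) = wave r"
proof -
  have "pi * (r + 2 * half_period) / half_period = pi * r / half_period + 2 * pi"
    using half_period_pos by (simp add: field_simps)
  then show ?thesis by (simp add: wave_def phase_def)
qed

lemma wave_deriv_interior:
  assumes "sin (pi * r / half_period) \<noteq> 0"
  shows "(wave has_real_derivative wave_velocity r) (at r)"
    "(wave_velocity has_real_derivative F (wave r)) (at r)"
proof -
  let ?\<sigma> = "sgn (sin (pi * r / half_period))"
  note p = phase_interior[OF assms]
  have w: "wave r = orbit (phase r)" using p by (simp add: wave_def half_wave_def)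
  have pl: "ereal (phase r) < lifetime" using p lifetime_eq by simp
  note o = orbit_deriv[OF p(1) pl]
  have "(half_wave has_real_derivative speed (wave r)) (at (phase r))"
    using o(1) unfolding w
    by (rule has_field_derivative_transform_within_open[where S = "{..<half_period}"])
      (use p in \<open>auto simp: half_wave_def\<close>)
  from DERIV_chain2[OF this p(3)]
  show d: "(wave has_real_derivative wave_velocity r) (at r)"
    unfolding wave_def wave_velocity_def by (simp add: mult.commute)
  have \<sigma>: "?\<sigma> * ?\<sigma> = 1" using assms by (simp add: sgn_if)
  have pos: "0 < speed (wave r)" unfolding w by (rule speed_pos[OF o(2,3)])
  have "((\<lambda>x. speed (wave x)) has_real_derivative F (wave r) / speed (wave r) * wave_velocity r) (at r)"
    using DERIV_chain2[OF speed_deriv d] o(2,3) w by simp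
  then have "((\<lambda>x. ?\<sigma> * speed (wave x)) has_real_derivative
      ?\<sigma> * (F (wave r) / speed (wave r) * wave_velocity r)) (at r)"
    by (rule DERIV_cmult)
  moreover have "?\<sigma> * (F (wave r) / speed (wave r) * wave_velocity r) = (?\<sigma> * ?\<sigma>) * F (wave r)"
    using pos by (simp add: wave_velocity_def)
  ultimately have "((\<lambda>x. ?\<sigma> * speed (wave x)) has_real_derivative F (wave r)) (at r)"
    unfolding \<sigma> by simp
  then show "(wave_velocity has_real_derivative F (wave r)) (at r)"
  proof (rule has_field_derivative_transform_within_open)
    let ?S = "{x. 0 < sin (pi * x / half_period) * sin (pi * r / half_period)}"
    show "open ?S"
      using half_period_pos by (intro open_Collect_less continuous_intros) auto
    show "r \<in> ?S" using assms by (simp flip: power2_eq_square)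
    show "?\<sigma> * speed (wave x) = wave_velocity x" if "x \<in> ?S" for x
      using that by (auto simp: wave_velocity_def sgn_if zero_less_mult_iff)
  qed
qed

text \<open>With the addition theorem for the sine: its zeros are \<open>half_period\<close> apart.\<close>

lemma turning_points_isolated:
  assumes "sin (pi * a / half_period) = 0"
  shows "eventually (\<lambda>r. sin (pi * r / half_period) \<noteq> 0) (at a)"
proof -
  have "sin (pi * r / half_period) \<noteq> 0" if r: "r \<noteq> a" "dist r a < half_period" for r
  proof -
    let ?d = "pi * (r - a) / half_period"
    have "pi * r / half_period = pi * a / half_period + ?d"
      by (simp add: algebra_simps flip: add_divide_distrib)
    then have "sin (pi * r / half_period) = cos (pi * a / half_period) * sin ?d"
      using assms by (simp add: sin_add)
    moreover have "cos (pi * a / half_period) \<noteq> 0"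
      using assms sin_cos_squared_add[of "pi * a / half_period"] by auto
    moreover have "sin ?d \<noteq> 0"
    proof
      assume "sin ?d = 0"
      moreover have "\<bar>(r - a) / half_period\<bar> < 1"
        using r half_period_pos by (simp add: dist_real_def)
      then have "\<bar>?d\<bar> < pi"
        using mult_strict_left_mono[of "\<bar>(r - a) / half_period\<bar>" 1 pi] by (simp add: abs_mult)
      then have "- pi < ?d" "?d < pi" by linarith+
      ultimately have "?d = 0" using sin_eq_0_pi by blast
      then show False using r half_period_pos by simp
    qed
    ultimately show ?thesis by simp
  qed
  then show ?thesis
    using half_period_pos by (auto simp: eventually_at)
qed

lemma speed_turning_point:
  assumes "sin (pi * r / half_period) = 0"
  shows "speed (wave r) = 0"
proof -
  have "(cos (pi * r / half_period))\<^sup>2 = 1"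
    using assms sin_cos_squared_add[of "pi * r / half_period"] by simp
  then have "cos (pi * r / half_period) = 1 \<or> cos (pi * r / half_period) = - 1"
    by (simp add: power2_eq_1_iff)
  then have "phase r = 0 \<or> phase r = half_period"
    using half_period_pos by (auto simp: phase_def)
  then show ?thesis
    using half_period_pos speed_top by (auto simp: wave_def half_wave_def)
qed

lemma speed_wave_nonneg: "0 \<le> speed (wave r)"
  using speed_pos[of "wave r"] wave_bounds[of r] speed_top
  by (cases "wave r = \<xi> \<or> wave r = b") (auto intro: less_imp_le)

text \<open>The kinks of the triangle wave sit at the turning points, where the speed vanishes. So the velocity
is continuous there in spite of the change of sign, and both derivatives extend across.\<close>

lemma wave_deriv:
  "(wave has_real_derivative wave_velocity r) (at r)"
  "(wave_velocity has_real_derivative F (wave r)) (at r)"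
proof -
  have "(wave has_real_derivative wave_velocity r) (at r) \<and>
    (wave_velocity has_real_derivative F (wave r)) (at r)"
  proof (cases "sin (pi * r / half_period) = 0")
    case False
    then show ?thesis using wave_deriv_interior by blast
  next
    case True
    have ev: "eventually (\<lambda>x. sin (pi * x / half_period) \<noteq> 0) (at r)"
      by (rule turning_points_isolated[OF True])
    have "((\<lambda>x. speed (wave x)) \<longlongrightarrow> 0) (at r)"
      using isCont_o2[OF isCont_wave isCont_speed, of r] speed_turning_point[OF True]
      by (simp add: isCont_def)
    then have "(wave_velocity \<longlongrightarrow> 0) (at r)"
      by (rule Lim_null_comparison[rotated])
        (auto simp: wave_velocity_def abs_mult sgn_if speed_wave_nonneg intro!: always_eventually)
    then have v: "isCont wave_velocity r"
      using True by (simp add: isCont_def wave_velocity_def)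
    have Fw: "isCont (\<lambda>x. F (wave x)) r"
      using F_cont by (intro isCont_o2[OF isCont_wave]) (simp add: continuous_on_eq_continuous_at)
    have "eventually (\<lambda>x. (wave has_real_derivative wave_velocity x) (at x)) (at r)"
      using ev by eventually_elim (rule wave_deriv_interior(1))
    then have "(wave has_real_derivative wave_velocity r) (at r)"
      by (rule DERIV_from_limit[OF isCont_wave v])
    moreover have "eventually (\<lambda>x. (wave_velocity has_real_derivative F (wave x)) (at x)) (at r)"
      using ev by eventually_elim (rule wave_deriv_interior(2))
    then have "(wave_velocity has_real_derivative F (wave r)) (at r)"
      by (rule DERIV_from_limit[OF v Fw])
    ultimately show ?thesis by blast
  qed
  then show "(wave has_real_derivative wave_velocity r) (at r)"
    "(wave_velocity has_real_derivative F (wave r)) (at r)" by auto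
qed

lemma wave_solves: "newton_solution F \<xi> \<infinity> wave"
  unfolding newton_solution_def
proof (intro conjI exI[of _ wave_velocity] ballI)
  show "(wave has_real_derivative wave_velocity r) (at r within half_open_ivl \<infinity>)" for r
    by (rule has_field_derivative_at_within[OF wave_deriv(1)])
  show "(wave_velocity has_real_derivative F (wave r)) (at r within half_open_ivl \<infinity>)" for r
    by (rule has_field_derivative_at_within[OF wave_deriv(2)])
qed (simp_all add: wave_start wave_velocity_def)

end

section \<open>Primitives, and maximal solutions from orbits\<close>

lemma primitive_deriv:
  assumes "continuous_on UNIV g"
  shows "(primitive g has_real_derivative g x) (at x)"
proof -
  define K where "K = \<bar>x\<bar> + 1"
  have "((\<lambda>t. LBINT s=ereal 0..ereal t. g s) has_vector_derivative g x) (at x within {- K..K})"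
    by (rule interval_integral_FTC2)
      (use assms in \<open>auto simp: K_def intro: continuous_on_subset\<close>)
  moreover have "at x within {- K..K} = at x"
    by (rule at_within_Icc_at) (auto simp: K_def)
  ultimately show ?thesis
    by (simp add: primitive_def[abs_def] has_real_derivative_iff_has_vector_derivative)
qed

lemma primitive_zero [simp]: "primitive g 0 = 0"
  by (simp add: primitive_def)

text \<open>Reflection \<open>u \<mapsto> - u\<close>. For an odd \<open>g\<close> it exchanges the two ellipticity constants
(\<open>pucci_force_uminus\<close> below), so a start at \<open>\<xi> > 0\<close> becomes a start at \<open>- \<xi> < 0\<close> with the roles of
\<open>\<lambda>\<close> and \<open>\<Lambda>\<close> swapped.\<close>

lemma newton_solution_uminus:
  assumes "newton_solution F \<xi> R u"
  shows "newton_solution (\<lambda>x. - F (- x)) (- \<xi>) R (\<lambda>r. - u r)"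
proof -
  obtain v where R: "0 < R" "u 0 = \<xi>" and v: "v 0 = 0"
    "\<And>r. r \<in> half_open_ivl R \<Longrightarrow> (u has_real_derivative v r) (at r within half_open_ivl R)"
    "\<And>r. r \<in> half_open_ivl R \<Longrightarrow> (v has_real_derivative F (u r)) (at r within half_open_ivl R)"
    using assms unfolding newton_solution_def by blast
  show ?thesis unfolding newton_solution_def
  proof (intro conjI exI[of _ "\<lambda>r. - v r"] ballI)
    fix r assume r: "r \<in> half_open_ivl R"
    show "((\<lambda>r. - u r) has_real_derivative - v r) (at r within half_open_ivl R)"
      by (rule DERIV_minus[OF v(2)[OF r]])
    show "((\<lambda>r. - v r) has_real_derivative - F (- (- u r))) (at r within half_open_ivl R)"
      using DERIV_minus[OF v(3)[OF r]] by simp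
  qed (simp_all add: R v)
qed

text \<open>The Pucci operator is strictly increasing in \<open>u''\<close>, so the equation can be solved for \<open>u''\<close>: this is
the resulting right-hand side, with \<open>p\<close> for \<open>\<lambda>\<close> and \<open>q\<close> for \<open>\<Lambda>\<close>. The order of \<open>p\<close> and \<open>q\<close> is left
open because of the reflection.\<close>

definition pucci_force :: "real \<Rightarrow> real \<Rightarrow> (real \<Rightarrow> real) \<Rightarrow> real \<Rightarrow> real" where
  "pucci_force p q g x = (if g x \<le> 0 then - g x / p else - g x / q)"

lemma pucci_force_cont:
  assumes "continuous_on UNIV g"
  shows "continuous_on UNIV (pucci_force p q g)"
proof -
  have "pucci_force p q g = (\<lambda>x. max (- g x) 0 / p + min (- g x) 0 / q)"
    by (rule ext) (auto simp: pucci_force_def max_def min_def)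
  then show ?thesis
    using assms by (auto simp: divide_inverse intro!: continuous_intros)
qed

lemma pucci_force_uminus:
  assumes "\<And>t. g (- t) = - g t"
  shows "- pucci_force p q g (- x) = pucci_force q p g x"
  using assms by (auto simp: pucci_force_def)

lemma is_solution_pucci_force:
  assumes sol: "newton_solution (pucci_force lam Lam g) \<xi> R u"
    and "0 < lam" "0 < Lam" and g: "continuous_on UNIV g"
  shows "is_solution lam Lam g \<xi> R u"
proof -
  let ?F = "pucci_force lam Lam g"
  obtain v where R: "0 < R" "u 0 = \<xi>" and v: "v 0 = 0"
    "\<And>r. r \<in> half_open_ivl R \<Longrightarrow> (u has_real_derivative v r) (at r within half_open_ivl R)"
    "\<And>r. r \<in> half_open_ivl R \<Longrightarrow> (v has_real_derivative ?F (u r)) (at r within half_open_ivl R)"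
    using sol unfolding newton_solution_def by blast
  have "continuous_on (half_open_ivl R) u"
    by (rule DERIV_continuous_on) (rule v(2))
  then have "continuous_on (half_open_ivl R) (\<lambda>r. ?F (u r))"
    by (rule continuous_on_compose2[OF pucci_force_cont[OF g]]) simp
  moreover have "pucci_minus lam Lam (?F x) + g x = 0" for x
    using assms(2,3) by (simp add: pucci_minus_def pucci_force_def field_simps)
  ultimately show ?thesis
    unfolding is_solution_def using R v
    by (intro conjI exI[of _ v] exI[of _ "\<lambda>r. ?F (u r)"]) auto
qed

lemma maximal_if_global:
  "is_solution lam Lam g \<xi> \<infinity> u \<Longrightarrow> is_maximal_solution lam Lam g \<xi> \<infinity> u"
  by (simp add: is_maximal_solution_def)

text \<open>An extension would be continuous, hence bounded, at \<open>R\<close>.\<close>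

lemma maximal_if_blow_up:
  assumes sol: "is_solution lam Lam g \<xi> R u"
    and blow: "filterlim (\<lambda>r. \<bar>u (real_of_ereal r)\<bar>) at_top (at_left R)"
  shows "is_maximal_solution lam Lam g \<xi> R u"
  unfolding is_maximal_solution_def
proof (intro conjI sol notI)
  assume "\<exists>R' v. R < R' \<and> is_solution lam Lam g \<xi> R' v \<and> (\<forall>r\<in>half_open_ivl R. v r = u r)"
  then obtain R' v where v: "R < R'" "is_solution lam Lam g \<xi> R' v"
    "\<And>r. r \<in> half_open_ivl R \<Longrightarrow> v r = u r" by blast
  have "0 < R" using sol by (simp add: is_solution_def)
  with v(1) obtain \<rho> where \<rho>: "R = ereal \<rho>" "0 < \<rho>" by (cases R) auto
  have \<rho>': "\<rho> \<in> half_open_ivl R'" using \<rho> v(1) by (simp add: half_open_ivl_def)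
  obtain d where "(v has_real_derivative d) (at \<rho> within half_open_ivl R')"
    using v(2) \<rho>' unfolding is_solution_def by blast
  then have "(v \<longlongrightarrow> v \<rho>) (at \<rho> within half_open_ivl R')"
    using DERIV_continuous continuous_within by blast
  then have "(v \<longlongrightarrow> v \<rho>) (at \<rho> within {0..\<rho>})"
  proof (rule tendsto_within_subset)
    show "{0..\<rho>} \<subseteq> half_open_ivl R'"
      using v(1) \<rho> le_less_trans[of "ereal _" "ereal \<rho>" R'] by (auto simp: half_open_ivl_def)
  qed
  then have "(v \<longlongrightarrow> v \<rho>) (at_left \<rho>)"
    using \<rho>(2) by (simp add: at_within_Icc_at_left)
  then have "((\<lambda>r. \<bar>v r\<bar>) \<longlongrightarrow> \<bar>v \<rho>\<bar>) (at_left \<rho>)" by (rule tendsto_rabs)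
  then have near: "eventually (\<lambda>r. \<bar>v r\<bar> < \<bar>v \<rho>\<bar> + 1) (at_left \<rho>)"
    by (rule order_tendstoD(2)) simp
  have "filterlim (\<lambda>r. \<bar>u r\<bar>) at_top (at_left \<rho>)"
    using blow unfolding \<rho> at_left_ereal filterlim_filtermap by simp
  then have far: "eventually (\<lambda>r. \<bar>v \<rho>\<bar> + 1 \<le> \<bar>u r\<bar>) (at_left \<rho>)"
    by (simp add: filterlim_at_top)
  have ivl: "eventually (\<lambda>r. r \<in> {0<..<\<rho>}) (at_left \<rho>)"
    using \<rho>(2) by (rule eventually_at_left_real)
  have "eventually (\<lambda>r. False) (at_left \<rho>)"
    using near far ivl
  proof eventually_elim
    case (elim r)
    then have "v r = u r" using \<rho> by (intro v(3)) (simp add: half_open_ivl_def)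
    with elim show False by simp
  qed
  then show False by (simp add: trivial_limit_at_left_real)
qed

text \<open>By continuity \<open>\<bar>u\<bar>\<close> comes arbitrarily close to its maximum on a whole interval, which is not a null
set.\<close>

lemma Linf_norm_eq_max:
  assumes cont: "continuous_on {0..} u" and le: "\<And>r. 0 \<le> r \<Longrightarrow> \<bar>u r\<bar> \<le> M"
    and s: "0 \<le> s" "\<bar>u s\<bar> = M"
  shows "Linf_norm u = ereal M"
proof (rule antisym)
  have "u \<in> borel_measurable (lebesgue_on {0..})"
    using cont by (intro continuous_imp_measurable_on_sets_lebesgue) auto
  then have meas: "(\<lambda>r. ereal \<bar>u r\<bar>) \<in> borel_measurable (lebesgue_on {0..})" by simp
  show "Linf_norm u \<le> ereal M"
    unfolding Linf_norm_def using le by (intro esssup_I meas) (auto intro!: AE_I2)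
  show "ereal M \<le> Linf_norm u"
  proof (rule ccontr)
    assume "\<not> ereal M \<le> Linf_norm u"
    then obtain c where c: "Linf_norm u < ereal c" "c < M"
      using ereal_dense2[of "Linf_norm u" "ereal M"] by (auto simp: not_le)
    have "((\<lambda>r. \<bar>u r\<bar>) \<longlongrightarrow> M) (at s within {0..})"
      using cont s by (auto simp: continuous_on_def intro!: tendsto_rabs)
    then have "eventually (\<lambda>r. c < \<bar>u r\<bar>) (at s within {0..})"
      using c(2) by (rule order_tendstoD(1))
    then obtain d where d: "0 < d" "\<And>r. 0 \<le> r \<Longrightarrow> r \<noteq> s \<Longrightarrow> dist r s < d \<Longrightarrow> c < \<bar>u r\<bar>"
      by (auto simp: eventually_at)
    have "AE r in lebesgue_on {0..}. ereal \<bar>u r\<bar> \<le> Linf_norm u"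
      unfolding Linf_norm_def by (rule esssup_AE)
    then have "AE r in lebesgue. r \<in> {0..} \<longrightarrow> ereal \<bar>u r\<bar> \<le> Linf_norm u"
      by (subst (asm) AE_restrict_space_iff) auto
    then have "AE r in lebesgue. r \<notin> {s<..<s + d}"
    proof eventually_elim
      case (elim r)
      show ?case
      proof
        assume r: "r \<in> {s<..<s + d}"
        then have "c < \<bar>u r\<bar>" using s d(2)[of r] by (auto simp: dist_real_def)
        moreover have "ereal \<bar>u r\<bar> < ereal c"
          using elim r s(1) by (intro le_less_trans[OF _ c(1)]) simp
        ultimately show False by simp
      qed
    qed
    then have "{s<..<s + d} \<in> null_sets lebesgue"
      by (subst AE_iff_null_sets) auto
    then show False using d(1) by (auto simp: null_sets_def)
  qed
qed

lemma (in rising_orbit) orbit_to_infinity: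
  assumes "\<beta> = \<infinity>"
  shows "strictly_increases_to_infinity lifetime orbit"
  unfolding strictly_increases_to_infinity_def
proof (intro conjI orbit_strict_mono)
  show "filterlim (orbit \<circ> real_of_ereal) at_top (at_left lifetime)"
    unfolding filterlim_at_top_dense comp_def
    using orbit_eventually_above assms by simp
qed

lemma (in rising_orbit) orbit_ge: "r \<in> half_open_ivl lifetime \<Longrightarrow> \<xi> \<le> orbit r"
  using orbit_in_range in_range_ge by blast

lemma strictly_increases_to_infinity_abs:
  assumes "strictly_increases_to_infinity R u" and "\<And>r. r \<in> half_open_ivl R \<Longrightarrow> 0 \<le> u r"
  shows "strictly_increases_to_infinity R (\<lambda>r. \<bar>u r\<bar>)"
  unfolding strictly_increases_to_infinity_def
proof
  show "strict_mono_on (half_open_ivl R) (\<lambda>r. \<bar>u r\<bar>)"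
    using assms by (auto simp: strictly_increases_to_infinity_def strict_mono_on_def)
  show "filterlim ((\<lambda>r. \<bar>u r\<bar>) \<circ> real_of_ereal) at_top (at_left R)"
    using assms(1) unfolding strictly_increases_to_infinity_def
    by (auto simp: comp_def elim!: filterlim_at_top_mono intro!: always_eventually)
qed

section \<open>The potential well of the Pucci equation\<close>

locale pucci_well =
  fixes p q :: real and g :: "real \<Rightarrow> real" and \<alpha> :: ereal
  assumes p: "0 < p" and q: "0 < q"
    and lipschitz: "local_lipschitz (UNIV :: real set) UNIV (\<lambda>_. g)"
    and odd: "\<And>t. g (- t) = - g t"
    and \<alpha>_pos: "0 < \<alpha>"
    and g_pos: "\<And>t. 0 < t \<Longrightarrow> ereal t < \<alpha> \<Longrightarrow> 0 < g t"
    and g_neg: "\<And>t. \<alpha> < ereal t \<Longrightarrow> g t < 0"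
begin

abbreviation "F \<equiv> pucci_force p q g"
abbreviation "\<Psi> \<equiv> primitive F"
abbreviation "G \<equiv> primitive g"

lemma lipschitz_near:
  obtains u L where "0 < u" "\<And>x y. \<bar>x - a\<bar> \<le> u \<Longrightarrow> \<bar>y - a\<bar> \<le> u \<Longrightarrow> \<bar>g x - g y\<bar> \<le> L * \<bar>x - y\<bar>"
proof -
  have "\<exists>u>0. \<exists>L. \<forall>t\<in>cball (0 :: real) u \<inter> UNIV. L-lipschitz_on (cball a u \<inter> UNIV) g"
    by (rule bspec[OF bspec[OF lipschitz[unfolded local_lipschitz_def] UNIV_I] UNIV_I])
  then obtain u L where u: "0 < u"
    and L: "\<forall>t\<in>cball (0 :: real) u \<inter> UNIV. L-lipschitz_on (cball a u \<inter> UNIV) g" by auto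
  have "L-lipschitz_on (cball a u) g" using bspec[OF L, of 0] u by simp
  then have "\<bar>g x - g y\<bar> \<le> L * \<bar>x - y\<bar>" if "\<bar>x - a\<bar> \<le> u" "\<bar>y - a\<bar> \<le> u" for x y
    using that lipschitz_onD[of L "cball a u" g x y] by (simp add: dist_real_def abs_minus_commute)
  with u that show ?thesis by blast
qed

lemma g_cont: "continuous_on UNIV g"
proof -
  have "isCont g a" for a
  proof -
    obtain u L where u: "0 < u" "\<And>x y. \<bar>x - a\<bar> \<le> u \<Longrightarrow> \<bar>y - a\<bar> \<le> u \<Longrightarrow> \<bar>g x - g y\<bar> \<le> L * \<bar>x - y\<bar>"
      using lipschitz_near[of a] by blast
    have "((\<lambda>x. g x - g a) \<longlongrightarrow> 0) (at a)"
    proof (rule Lim_null_comparison)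
      have "eventually (\<lambda>x. dist x a < u) (at a)" using u(1) by (auto simp: eventually_at)
      then show "eventually (\<lambda>x. norm (g x - g a) \<le> L * \<bar>x - a\<bar>) (at a)"
        by eventually_elim (use u in \<open>auto simp: dist_real_def\<close>)
      have "((\<lambda>x. L * \<bar>x - a\<bar>) \<longlongrightarrow> L * \<bar>a - a\<bar>) (at a)"
        by (intro tendsto_intros)
      then show "((\<lambda>x. L * \<bar>x - a\<bar>) \<longlongrightarrow> 0) (at a)" by simp
    qed
    then show ?thesis by (simp add: isCont_def LIM_zero_iff)
  qed
  then show ?thesis by (simp add: continuous_on_eq_continuous_at)
qed

lemmas F_cont = pucci_force_cont[OF g_cont]
lemmas \<Psi>_deriv = primitive_deriv[OF F_cont]
lemmas G_deriv = primitive_deriv[OF g_cont]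

lemma G_even: "G (- x) = G x"
proof -
  have "((\<lambda>x. G (- x) - G x) has_real_derivative 0) (at x)" for x
  proof -
    have "((\<lambda>x. G (- x)) has_real_derivative g (- x) * - 1) (at x)"
      by (rule DERIV_chain2[where f = G, OF G_deriv]) (rule derivative_eq_intros refl | simp)+
    from DERIV_diff[OF this G_deriv[of x]] show ?thesis by (simp add: odd)
  qed
  from DERIV_isconst_all[of "\<lambda>x. G (- x) - G x", OF allI[OF this], of x 0] show ?thesis
    by simp
qed

lemma g_zero [simp]: "g 0 = 0"
  using odd[of 0] by simp

lemma g_neg_left: "- \<alpha> < ereal t \<Longrightarrow> t < 0 \<Longrightarrow> g t < 0"
  using g_pos[of "- t"] odd[of t] by (cases \<alpha>) auto

lemma g_\<alpha>:
  assumes "\<alpha> = ereal a" shows "g a = 0"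
proof (rule antisym)
  have lim: "(g \<longlongrightarrow> g a) (at a)" using g_cont by (simp add: continuous_on_def)
  have a: "0 < a" using \<alpha>_pos assms by simp
  have "(g \<longlongrightarrow> g a) (at_left a)" using lim by (rule tendsto_mono[OF at_le, rotated]) simp
  moreover have "eventually (\<lambda>x. 0 \<le> g x) (at_left a)"
    using eventually_at_left_real[OF a] by eventually_elim (use g_pos assms in \<open>auto intro!: less_imp_le\<close>)
  ultimately show "0 \<le> g a" by (rule tendsto_lowerbound) simp
  have "(g \<longlongrightarrow> g a) (at_right a)" using lim by (rule tendsto_mono[OF at_le, rotated]) simp
  moreover have "eventually (\<lambda>x. g x \<le> 0) (at_right a)"
    using eventually_at_right_real[of a "a + 1"]
    by (auto elim!: eventually_mono intro!: less_imp_le g_neg simp: assms)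
  ultimately show "g a \<le> 0" by (rule tendsto_upperbound) simp
qed

text \<open>Where the force is \<open>- g / c\<close>, its potential is that of \<open>g\<close> up to the factor \<open>1 / c\<close>. The sign of \<open>g\<close> makes
\<open>c = p\<close> on \<open>(- \<alpha>, 0)\<close> and on \<open>(\<alpha>, \<infinity>)\<close>, and \<open>c = q\<close> on \<open>(0, \<alpha>)\<close>.\<close>

lemma potential_diff:
  assumes "a \<le> b" and "\<And>x. a < x \<Longrightarrow> x < b \<Longrightarrow> F x = - g x / c"
  shows "\<Psi> b - \<Psi> a = - (G b - G a) / c"
proof (cases "a = b")
  case False
  then have ab: "a < b" using assms(1) by simp
  have D: "((\<lambda>x. \<Psi> x + G x / c) has_real_derivative F x + g x / c) (at x)" for x
    by (intro DERIV_add DERIV_cdivide \<Psi>_deriv G_deriv)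
  have "(\<lambda>x. \<Psi> x + G x / c) b = (\<lambda>x. \<Psi> x + G x / c) a"
  proof (rule DERIV_isconst_end[OF ab])
    show "continuous_on {a..b} (\<lambda>x. \<Psi> x + G x / c)"
      using D by (meson DERIV_atLeastAtMost_imp_continuous_on)
    show "((\<lambda>x. \<Psi> x + G x / c) has_real_derivative 0) (at x)" if "a < x" "x < b" for x
      using D[of x] assms(2)[OF that] by simp
  qed
  then show ?thesis by (simp add: diff_divide_distrib)
qed simp

lemma potential_left:
  assumes "- \<alpha> \<le> ereal a" "a \<le> b" "b \<le> 0"
  shows "\<Psi> b - \<Psi> a = (G a - G b) / p"
proof -
  have "F x = - g x / p" if "a < x" "x < b" for x
  proof -
    have "- \<alpha> < ereal x" using assms(1) that le_less_trans[of "- \<alpha>" "ereal a" "ereal x"] by simp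
    then show ?thesis using g_neg_left[of x] that assms(3) by (simp add: pucci_force_def)
  qed
  from potential_diff[OF assms(2) this] show ?thesis by (simp add: field_simps)
qed

lemma potential_right:
  assumes "0 \<le> b" "ereal b \<le> \<alpha>"
  shows "\<Psi> b = - G b / q"
proof -
  have "F x = - g x / q" if "0 < x" "x < b" for x
  proof -
    have "ereal x < \<alpha>" using assms(2) that less_le_trans[of "ereal x" "ereal b" \<alpha>] by simp
    then show ?thesis using g_pos[of x] that by (simp add: pucci_force_def)
  qed
  from potential_diff[OF assms(1) this] show ?thesis by simp
qed

lemma potential_beyond:
  assumes "\<alpha> \<le> ereal a" "a \<le> b"
  shows "\<Psi> b - \<Psi> a = (G a - G b) / p"
proof -
  have "F x = - g x / p" if "a < x" "x < b" for x
  proof -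
    have "\<alpha> < ereal x" using assms(1) that le_less_trans[of \<alpha> "ereal a" "ereal x"] by simp
    then show ?thesis using g_neg[of x] that by (simp add: pucci_force_def)
  qed
  from potential_diff[OF assms(2) this] show ?thesis by (simp add: field_simps)
qed

lemma G_isCont: "isCont G x"
  using G_deriv by (rule DERIV_isCont)

lemma G_less:
  assumes "0 \<le> a" "a < b" "ereal b \<le> \<alpha>"
  shows "G a < G b"
proof (rule DERIV_pos_imp_increasing_open[OF assms(2)])
  fix x assume x: "a < x" "x < b"
  then have "ereal x < \<alpha>" using assms(3) less_le_trans[of "ereal x" "ereal b" \<alpha>] by simp
  then show "\<exists>y. (G has_real_derivative y) (at x) \<and> 0 < y"
    using g_pos[of x] G_deriv[of x] x assms(1) by auto
qed (simp add: continuous_at_imp_continuous_on G_isCont)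

lemma G_less_beyond:
  assumes "\<alpha> \<le> ereal a" "a < b"
  shows "G b < G a"
proof (rule DERIV_neg_imp_decreasing_open[OF assms(2)])
  fix x assume x: "a < x" "x < b"
  then have "\<alpha> < ereal x" using assms(1) le_less_trans[of \<alpha> "ereal a" "ereal x"] by simp
  then show "\<exists>y. (G has_real_derivative y) (at x) \<and> y < 0"
    using g_neg[of x] G_deriv[of x] by auto
qed (simp add: continuous_at_imp_continuous_on G_isCont)

text \<open>As \<open>G\<close> increases on \<open>(0, \<alpha>)\<close>, its value at \<open>\<alpha>\<close> is a supremum, uniformly for finite and infinite \<open>\<alpha>\<close>.\<close>

lemma primitive_at_SUP: "primitive_at g \<alpha> = (SUP y\<in>{y. 0 < y \<and> ereal y < \<alpha>}. ereal (G y))"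
  (is "_ = ?S")
proof -
  show ?thesis
  proof (cases "\<alpha> = \<infinity>")
    case True
    have "((\<lambda>t. ereal (G t)) \<longlongrightarrow> ?S) at_top"
    proof (rule order_tendstoI)
      fix c assume "c < ?S"
      then obtain y where y: "0 < y" "c < ereal (G y)" by (auto simp: less_SUP_iff)
      show "eventually (\<lambda>t. c < ereal (G t)) at_top"
        using eventually_gt_at_top[of y]
      proof eventually_elim
        case (elim t)
        then have "G y < G t" using y(1) True by (intro G_less) auto
        then show ?case using y(2) less_trans[of c "ereal (G y)" "ereal (G t)"] by simp
      qed
    next
      fix c assume "?S < c"
      show "eventually (\<lambda>t. ereal (G t) < c) at_top"
        using eventually_gt_at_top[of "0 :: real"]
      proof eventually_elim
        case (elim t)
        then have "ereal (G t) \<le> ?S" using True by (intro SUP_upper) auto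
        with \<open>?S < c\<close> show ?case by simp
      qed
    qed
    then show ?thesis using True by (simp add: primitive_at_def tendsto_Lim)
  next
    case False
    then obtain a where a: "\<alpha> = ereal a" "0 < a" using \<alpha>_pos by (cases \<alpha>) auto
    have "ereal (G a) = ?S"
    proof (rule antisym)
      show "?S \<le> ereal (G a)"
        using G_less a by (intro SUP_least) (auto intro!: less_imp_le)
      have "(G \<longlongrightarrow> G a) (at_left a)"
        using G_isCont[of a] unfolding isCont_def by (rule tendsto_mono[OF at_le, rotated]) simp
      then have "((\<lambda>y. ereal (G y)) \<longlongrightarrow> ereal (G a)) (at_left a)" by simp
      moreover have "eventually (\<lambda>y. ereal (G y) \<le> ?S) (at_left a)"
        using eventually_at_left_real[OF a(2)]
        by eventually_elim (use a in \<open>auto intro!: SUP_upper\<close>)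
      ultimately show "ereal (G a) \<le> ?S" by (rule tendsto_upperbound) simp
    qed
    then show ?thesis using a by (simp add: primitive_at_def)
  qed
qed

lemma G_less_primitive_at:
  assumes "0 \<le> x" "ereal x < \<alpha>"
  shows "ereal (G x) < primitive_at g \<alpha>"
proof -
  obtain y where y: "ereal x < ereal y" "ereal y < \<alpha>" using ereal_dense2[OF assms(2)] by auto
  then have "ereal (G x) < ereal (G y)" using G_less[OF assms(1), of y] by simp
  also have "\<dots> \<le> primitive_at g \<alpha>"
    unfolding primitive_at_SUP using y assms(1) by (intro SUP_upper) auto
  finally show ?thesis .
qed

end

section \<open>The orbits of the Pucci equation\<close>

context pucci_well
begin

lemma force_at_start_left: "- \<alpha> < ereal \<xi> \<Longrightarrow> \<xi> < 0 \<Longrightarrow> 0 < F \<xi>"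
  using g_neg_left[of \<xi>] p by (simp add: pucci_force_def divide_neg_pos)

lemma force_neg_right: "0 < x \<Longrightarrow> ereal x < \<alpha> \<Longrightarrow> F x < 0"
  using g_pos[of x] q by (simp add: pucci_force_def)

lemma above_start_left:
  assumes "- \<alpha> < ereal \<xi>" "\<xi> < x" "x \<le> 0"
  shows "\<Psi> \<xi> < \<Psi> x"
proof -
  have "ereal (- \<xi>) \<le> \<alpha>" using assms(1) by (cases \<alpha>) auto
  then have "G (- x) < G (- \<xi>)" using assms by (intro G_less) auto
  moreover have "\<Psi> x - \<Psi> \<xi> = (G \<xi> - G x) / p"
    using assms by (intro potential_left) auto
  moreover have "0 < (G \<xi> - G x) / p"
    using \<open>G (- x) < G (- \<xi>)\<close> p by (simp add: G_even)
  ultimately show ?thesis by linarith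
qed

lemma potential_start:
  assumes "- \<alpha> < ereal \<xi>" "\<xi> < 0"
  shows "\<Psi> \<xi> = - G \<xi> / p"
  using potential_left[of \<xi> 0] assms by (simp add: less_imp_le)

text \<open>To the right of \<open>0\<close> the energy of a particle released at \<open>\<xi> < 0\<close> is compared through \<open>p * G x\<close> and
\<open>q * G \<xi>\<close>. So the motion is decided by how \<open>q * G \<xi>\<close> compares with \<open>p * G \<alpha>\<close>.\<close>

lemma above_start_right:
  assumes "- \<alpha> < ereal \<xi>" "\<xi> < 0" "0 \<le> x" "ereal x \<le> \<alpha>"
  shows "\<Psi> \<xi> < \<Psi> x \<longleftrightarrow> p * G x < q * G \<xi>"
  unfolding potential_start[OF assms(1,2)] potential_right[OF assms(3,4)]
  using p q by (simp add: field_simps)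

lemma level_start_right:
  assumes "- \<alpha> < ereal \<xi>" "\<xi> < 0" "0 \<le> x" "ereal x \<le> \<alpha>"
  shows "\<Psi> x = \<Psi> \<xi> \<longleftrightarrow> p * G x = q * G \<xi>"
  unfolding potential_start[OF assms(1,2)] potential_right[OF assms(3,4)]
  using p q by (auto simp: field_simps)

lemma primitive_at_cases:
  obtains P where "primitive_at g \<alpha> = ereal P" "0 < P" | "primitive_at g \<alpha> = \<infinity>"
  using G_less_primitive_at[of 0] \<alpha>_pos that
  by (cases "primitive_at g \<alpha>") (auto simp: zero_ereal_def)

lemma primitive_at_\<alpha>: "\<alpha> = ereal a \<Longrightarrow> primitive_at g \<alpha> = ereal (G a)"
  by (simp add: primitive_at_def)

text \<open>Below the threshold the energy level is met at some \<open>b\<close> in \<open>(0, \<alpha>)\<close>, by the intermediate value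
theorem, and the force at \<open>b\<close> points back.\<close>

lemma rebound:
  assumes \<xi>: "- \<alpha> < ereal \<xi>" "\<xi> < 0"
    and sub: "ereal (q * G \<xi>) < ereal p * primitive_at g \<alpha>"
  obtains b where "0 < b" "ereal b < \<alpha>" "p * G b = q * G \<xi>" "rebounding_orbit F \<Psi> \<xi> b"
proof -
  define c where "c = q * G \<xi> / p"
  have "ereal c < primitive_at g \<alpha>"
    using sub p by (cases rule: primitive_at_cases) (auto simp: c_def field_simps)
  then obtain y where y: "0 < y" "ereal y < \<alpha>" "c < G y"
    unfolding primitive_at_SUP by (auto simp: less_SUP_iff)
  have "G 0 < G (- \<xi>)"
    using \<xi> by (intro G_less) (cases \<alpha>; auto)+
  then have c: "0 < c" using p q by (simp add: c_def G_even)
  obtain b where b: "0 \<le> b" "b \<le> y" "G b = c"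
    using IVT'[of G 0 c y] c y by (auto simp: continuous_at_imp_continuous_on G_isCont)
  have b0: "0 < b" using b c by (cases "b = 0") auto
  have b\<alpha>: "ereal b < \<alpha>" using b(2) y(2) le_less_trans[of "ereal b" "ereal y" \<alpha>] by simp
  have level: "p * G b = q * G \<xi>" using b(3) p by (simp add: c_def)
  have "rebounding_orbit F \<Psi> \<xi> b"
  proof
    show "\<Psi> \<xi> < \<Psi> x" if "\<xi> < x" "ereal x < ereal b" for x
    proof (cases "x \<le> 0")
      case True
      then show ?thesis using above_start_left[OF \<xi>(1)] that by simp
    next
      case False
      then have "G x < G b" using that b\<alpha> by (intro G_less) auto
      moreover have "ereal x \<le> \<alpha>" using that b\<alpha> less_trans[of "ereal x" "ereal b" \<alpha>] by simp
      ultimately show ?thesis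
        using above_start_right[OF \<xi>, of x] False p unfolding level[symmetric] by simp
    qed
    show "continuous_on UNIV F" by (rule F_cont)
    show "(\<Psi> has_real_derivative F x) (at x)" for x by (rule \<Psi>_deriv)
    show "ereal \<xi> < ereal b" using \<xi>(2) b0 by simp
    show "0 < F \<xi>" by (rule force_at_start_left[OF \<xi>])
    show "F b < 0" by (rule force_neg_right[OF b0 b\<alpha>])
    show "\<Psi> b = \<Psi> \<xi>"
      using level_start_right[OF \<xi>, of b] b0 b\<alpha> level by (simp add: less_imp_le)
  qed
  with b0 b\<alpha> level that show ?thesis by blast
qed

text \<open>The solution passes through \<open>0\<close> while it climbs from \<open>\<xi> < 0\<close> to \<open>b > 0\<close>, so by periodicity it
oscillates. Its range is \<open>[\<xi>, b]\<close>; which end is larger in absolute value depends on the order of \<open>p\<close>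
and \<open>q\<close>.\<close>

lemma rebound_solution:
  assumes \<xi>: "- \<alpha> < ereal \<xi>" "\<xi> < 0"
    and sub: "ereal (q * G \<xi>) < ereal p * primitive_at g \<alpha>"
  obtains u b \<tau> where "newton_solution F \<xi> \<infinity> u" "periodic u" "oscillating u"
    "continuous_on UNIV u" "\<And>r. \<xi> \<le> u r" "\<And>r. u r \<le> b" "u 0 = \<xi>"
    "0 < \<tau>" "u \<tau> = b" "\<And>r. 0 \<le> r \<Longrightarrow> r < \<tau> \<Longrightarrow> u r < b"
    "0 < b" "ereal b < \<alpha>" "p * G b = q * G \<xi>"
proof -
  obtain b where b: "0 < b" "ereal b < \<alpha>" "p * G b = q * G \<xi>" "rebounding_orbit F \<Psi> \<xi> b"
    using rebound[OF assms] by blast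
  interpret rebounding_orbit F \<Psi> \<xi> b by (rule b(4))
  have "periodic wave"
    unfolding periodic_def using half_period_pos wave_periodic
    by (intro exI[of _ "2 * half_period"]) auto
  moreover have "oscillating wave"
  proof -
    obtain z where z: "0 \<le> z" "wave z = 0"
      using IVT'[of wave 0 0 half_period] wave_start wave_top \<xi>(2) b(1) half_period_pos
        continuous_on_subset[OF wave_cont] by auto
    have zeros: "wave (z + real n * (2 * half_period)) = 0" for n
    proof (induction n)
      case (Suc n)
      then show ?case
        using wave_periodic[of "z + real n * (2 * half_period)"] by (simp add: algebra_simps)
    qed (simp add: z)
    have "\<not> bounded (range (\<lambda>n. z + real n * (2 * half_period)))"
    proof
      assume "bounded (range (\<lambda>n. z + real n * (2 * half_period)))"
      then obtain B where B: "\<And>n. \<bar>z + real n * (2 * half_period)\<bar> \<le> B"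
        by (auto simp: bounded_iff)
      obtain n where "B < real n * (2 * half_period)"
        using ex_less_of_nat_mult[of "2 * half_period" B] half_period_pos by auto
      then show False using B[of n] z(1) by linarith
    qed
    then show ?thesis
      unfolding oscillating_def using zeros z(1) half_period_pos
      by (intro exI[of _ "\<lambda>n. z + real n * (2 * half_period)"]) auto
  qed
  ultimately show ?thesis
    using that[of wave b half_period] b wave_solves wave_cont wave_bounds wave_start
      half_period_pos wave_top wave_before_top by blast
qed

text \<open>Here local Lipschitz continuity enters: since \<open>g\<close> vanishes at a finite \<open>\<alpha>\<close>, the force near \<open>\<alpha>\<close>
is at most a multiple of the distance to \<open>\<alpha>\<close>.\<close>

lemma equilibrium_barrier:
  assumes "\<alpha> = ereal a" "\<xi> < 0"
  obtains x1 L where "\<xi> < x1" "x1 < a" "\<And>x. x1 \<le> x \<Longrightarrow> x \<le> a \<Longrightarrow> - L * (a - x) \<le> F x"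
proof -
  obtain u L where u: "0 < u" and L: "\<And>x y. \<bar>x - a\<bar> \<le> u \<Longrightarrow> \<bar>y - a\<bar> \<le> u \<Longrightarrow> \<bar>g x - g y\<bar> \<le> L * \<bar>x - y\<bar>"
    using lipschitz_near[of a] by blast
  have a: "0 < a" using \<alpha>_pos assms(1) by simp
  define x1 where "x1 = max (a / 2) (a - u)"
  have x1: "0 < x1" "x1 < a" "a - u \<le> x1" using a u by (auto simp: x1_def)
  have "- (L / q) * (a - x) \<le> F x" if x: "x1 \<le> x" "x \<le> a" for x
  proof -
    have "0 \<le> g x"
      using g_pos[of x] x x1 assms(1) g_\<alpha>[OF assms(1)] by (cases "x = a") auto
    then have Fx: "F x = - g x / q" by (auto simp: pucci_force_def)
    have "\<bar>g x - g a\<bar> \<le> L * \<bar>x - a\<bar>" using x x1 u by (intro L) auto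
    then have "g x \<le> L * (a - x)" using g_\<alpha>[OF assms(1)] x \<open>0 \<le> g x\<close> by simp
    then have "g x / q \<le> L * (a - x) / q" using q by (intro divide_right_mono) auto
    then show ?thesis by (simp add: Fx)
  qed
  then show ?thesis using that[of x1 "L / q"] x1 assms(2) by simp
qed

text \<open>At the threshold the energy level is met exactly at \<open>\<alpha>\<close>, in the limit if \<open>\<alpha> = \<infinity>\<close>. A finite
\<open>\<alpha>\<close> is an equilibrium, which is never reached; for \<open>\<alpha> = \<infinity>\<close> the speed is bounded by its value at \<open>0\<close>, where \<open>\<Psi>\<close> is largest. In both cases
the orbit lives forever.\<close>

lemma threshold_solution:
  assumes \<xi>: "- \<alpha> < ereal \<xi>" "\<xi> < 0"
    and eq: "ereal (q * G \<xi>) = ereal p * primitive_at g \<alpha>"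
  obtains u where "newton_solution F \<xi> \<infinity> u" "strict_mono_on {0..} u"
    "\<And>r. 0 \<le> r \<Longrightarrow> \<xi> \<le> u r" "\<And>r. 0 \<le> r \<Longrightarrow> ereal (u r) < \<alpha>"
    "((\<lambda>r. ereal (u r)) \<longlongrightarrow> \<alpha>) at_top"
proof -
  obtain P where P: "primitive_at g \<alpha> = ereal P" "q * G \<xi> = p * P"
    using eq p by (cases rule: primitive_at_cases) auto
  have \<xi>\<alpha>: "ereal \<xi> < \<alpha>" using \<xi>(2) \<alpha>_pos by (cases \<alpha>) auto
  interpret rising_orbit F \<Psi> \<xi> \<alpha>
  proof
    show "\<Psi> \<xi> < \<Psi> x" if "\<xi> < x" "ereal x < \<alpha>" for x
    proof (cases "x \<le> 0")
      case True
      then show ?thesis using above_start_left[OF \<xi>(1)] that by simp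
    next
      case False
      then have "G x < P" using that(2) G_less_primitive_at[of x] P(1) by simp
      then show ?thesis using above_start_right[OF \<xi>, of x] False that(2) P(2) p by auto
    qed
  qed (use \<xi> \<xi>\<alpha> F_cont \<Psi>_deriv force_at_start_left in auto)
  have life: "lifetime = \<infinity>"
  proof (cases \<alpha>)
    case (real a)
    have a: "0 < a" using \<alpha>_pos real by simp
    have "\<Psi> a = \<Psi> \<xi>"
      using level_start_right[OF \<xi>, of a] a P primitive_at_\<alpha>[OF real] real by simp
    moreover obtain x1 L where "\<xi> < x1" "x1 < a"
      "\<And>x. x1 \<le> x \<Longrightarrow> x \<le> a \<Longrightarrow> - L * (a - x) \<le> F x"
      using equilibrium_barrier[OF real \<xi>(2)] by blast
    ultimately show ?thesis by (intro lifetime_infinite_if_equilibrium[OF real]) auto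
  next
    case PInf
    have "speed x \<le> sqrt (2 * (\<Psi> 0 - \<Psi> \<xi>))" if "\<xi> < x" for x
    proof -
      have "\<Psi> x \<le> \<Psi> 0"
      proof (cases "x < 0")
        case True
        then show ?thesis using above_start_left[of x 0] PInf by simp
      next
        case False
        then have "0 \<le> G x" using G_less[of 0 x] PInf by (cases "x = 0") auto
        then show ?thesis using potential_right[of x] False PInf q by simp
      qed
      then show ?thesis unfolding speed_def by (intro real_sqrt_le_mono) simp
    qed
    then show ?thesis by (rule lifetime_infinite_if_speed_bounded[OF PInf])
  qed (use \<alpha>_pos in auto)
  have ivl: "half_open_ivl lifetime = {0..}" by (auto simp: half_open_ivl_def life)
  have below: "ereal (orbit r) < \<alpha>" if "0 \<le> r" for r
    using orbit_in_range[of r] that ivl by (simp add: range_of_orbit_def)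
  have "((\<lambda>r. ereal (orbit r)) \<longlongrightarrow> \<alpha>) at_top"
  proof (rule order_tendstoI)
    fix c assume "c < \<alpha>"
    then obtain M where M: "c < ereal M" "ereal M < \<alpha>" using ereal_dense2 by blast
    then obtain t where t: "\<And>r. t < r \<Longrightarrow> ereal r < lifetime \<Longrightarrow> M < orbit r"
      using orbit_above_late by blast
    show "eventually (\<lambda>r. c < ereal (orbit r)) at_top"
      using eventually_gt_at_top[of t]
    proof eventually_elim
      case (elim r)
      then have "ereal M < ereal (orbit r)" using t[of r] life by simp
      with M(1) show ?case by (rule less_trans)
    qed
  next
    fix c assume "\<alpha> < c"
    show "eventually (\<lambda>r. ereal (orbit r) < c) at_top"
      using eventually_ge_at_top[of "0 :: real"]
      by eventually_elim (rule less_trans[OF below \<open>\<alpha> < c\<close>])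
  qed
  then show ?thesis
    using that[of orbit] orbit_solves orbit_strict_mono orbit_ge below unfolding life[symmetric] ivl
    by auto
qed

lemma escape:
  assumes "rising_orbit F \<Psi> \<xi> \<infinity>"
  obtains R u where "newton_solution F \<xi> R u" "strictly_increases_to_infinity R u"
    "\<And>r. r \<in> half_open_ivl R \<Longrightarrow> \<xi> \<le> u r"
proof -
  interpret rising_orbit F \<Psi> \<xi> \<infinity> by (rule assms)
  show ?thesis
    using that[of lifetime orbit] orbit_solves orbit_to_infinity orbit_ge by blast
qed

text \<open>Above the threshold the speed stays positive up to \<open>\<alpha>\<close>, inclusively if \<open>\<alpha>\<close> is finite. Beyond it the
force points to the right, so \<open>\<Psi>\<close> increases again and there is no further turning point.\<close>

lemma escape_over_barrier:
  assumes \<xi>: "- \<alpha> < ereal \<xi>" "\<xi> < 0"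
    and super: "ereal p * primitive_at g \<alpha> < ereal (q * G \<xi>)"
  shows "rising_orbit F \<Psi> \<xi> \<infinity>"
proof
  obtain P where P: "primitive_at g \<alpha> = ereal P" "p * P < q * G \<xi>"
    using super p by (cases rule: primitive_at_cases) auto
  fix x assume x: "\<xi> < x"
  consider "x \<le> 0" | "0 < x" "ereal x < \<alpha>" | "0 < x" "\<alpha> \<le> ereal x" by force
  then show "\<Psi> \<xi> < \<Psi> x"
  proof cases
    case 1
    then show ?thesis using above_start_left[OF \<xi>(1)] x by simp
  next
    case 2
    then have "p * G x < p * P" using G_less_primitive_at[of x] P(1) p by simp
    then show ?thesis using above_start_right[OF \<xi>, of x] 2 P(2) by simp
  next
    case 3
    then obtain a where a: "\<alpha> = ereal a" "0 < a" "a \<le> x" using \<alpha>_pos by (cases \<alpha>) auto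
    have "\<Psi> \<xi> < \<Psi> a"
      using above_start_right[OF \<xi>, of a] a P primitive_at_\<alpha>[OF a(1)] by simp
    also have "\<Psi> a \<le> \<Psi> x"
    proof -
      have "0 \<le> (G a - G x) / p"
        using G_less_beyond[of a x] a p by (cases "a = x") auto
      then show ?thesis using potential_beyond[of a x] a by simp
    qed
    finally show ?thesis .
  qed
qed (use \<xi> F_cont \<Psi>_deriv force_at_start_left in auto)

lemma escape_from_outside:
  assumes \<xi>: "\<alpha> < ereal \<xi>"
  shows "rising_orbit F \<Psi> \<xi> \<infinity>"
proof
  fix x assume x: "\<xi> < x"
  have "G x < G \<xi>" using \<xi> x by (intro G_less_beyond) auto
  then have "0 < (G \<xi> - G x) / p" using p by simp
  then show "\<Psi> \<xi> < \<Psi> x" using potential_beyond[of \<xi> x] \<xi> x by (simp add: less_imp_le)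
next
  show "0 < F \<xi>" using g_neg[OF \<xi>] p by (simp add: pucci_force_def divide_neg_pos)
qed (use F_cont \<Psi>_deriv in auto)

lemma constant_solution:
  assumes "ereal \<bar>\<xi>\<bar> = \<alpha> \<or> \<xi> = 0"
  shows "newton_solution F \<xi> \<infinity> (\<lambda>_. \<xi>)"
proof -
  have "g \<xi> = 0"
  proof (cases "\<xi> = 0")
    case False
    then have "g \<bar>\<xi>\<bar> = 0" using assms g_\<alpha>[of "\<bar>\<xi>\<bar>"] by auto
    then show ?thesis using odd[of \<xi>] by (cases "\<xi> < 0") auto
  qed simp
  then have "F \<xi> = 0" by (simp add: pucci_force_def)
  then show ?thesis
    unfolding newton_solution_def by (intro conjI exI[of _ "\<lambda>_. 0"]) auto
qed

end

section \<open>The classification of solutions\<close>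

theorem theorem2p2:
  fixes lam Lam \<xi> :: real and g :: "real \<Rightarrow> real" and \<alpha> :: ereal
  assumes "0 < lam" and "lam \<le> Lam"
    and g1: "local_lipschitz (UNIV :: real set) UNIV (\<lambda>_. g)"
    and g2: "\<And>t. g (- t) = - g t"
    and \<alpha>_pos: "0 < \<alpha>"
    and g3_pos: "\<And>t. 0 < t \<Longrightarrow> ereal t < \<alpha> \<Longrightarrow> 0 < g t"
    and g3_neg: "\<And>t. \<alpha> < ereal t \<Longrightarrow> g t < 0"
  shows "\<exists>R u. is_maximal_solution lam Lam g \<xi> R u
    \<and> (ereal \<bar>\<xi>\<bar> = \<alpha> \<or> \<xi> = 0 \<longrightarrow> (\<forall>r\<in>half_open_ivl R. u r = \<xi>))
    \<and> (\<alpha> \<noteq> \<infinity> \<and> \<alpha> < ereal \<bar>\<xi>\<bar> \<longrightarrow> strictly_increases_to_infinity R (\<lambda>r. \<bar>u r\<bar>))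
    \<and> (0 < \<xi> \<and> ereal \<xi> < \<alpha> \<longrightarrow>
          R = \<infinity> \<and> oscillating u \<and> periodic u \<and> Linf_norm u = ereal \<xi>)
    \<and> (- \<alpha> < ereal \<xi> \<and> \<xi> < 0 \<longrightarrow>
          (ereal (Lam * primitive g \<xi>) < ereal lam * primitive_at g \<alpha> \<longrightarrow>
             R = \<infinity> \<and> oscillating u \<and> periodic u \<and>
             (\<exists>r2. first_maximizer u r2 \<and> Linf_norm u = ereal (u r2) \<and> ereal (u r2) < \<alpha>))
        \<and> (ereal (Lam * primitive g \<xi>) = ereal lam * primitive_at g \<alpha> \<longrightarrow>
             R = \<infinity> \<and> (\<forall>r\<ge>0. - \<alpha> < ereal (u r) \<and> ereal (u r) < \<alpha>) \<and>
             strict_mono_on {0..} u \<and> ((\<lambda>r. ereal (u r)) \<longlongrightarrow> \<alpha>) at_top)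
        \<and> (ereal (Lam * primitive g \<xi>) > ereal lam * primitive_at g \<alpha> \<longrightarrow>
             strictly_increases_to_infinity R u))"
proof -
  have Lam: "0 < Lam" using assms(1,2) by simp
  interpret P: pucci_well lam Lam g \<alpha>
    by standard (use assms Lam in auto)
  interpret M: pucci_well Lam lam g \<alpha>
    by standard (use assms Lam in auto)
  have sol: "is_solution lam Lam g \<xi> R u" if "newton_solution P.F \<xi> R u" for R u
    by (rule is_solution_pucci_force[OF that assms(1) Lam P.g_cont])
  have mirror: "newton_solution P.F \<xi> R (\<lambda>r. - u r)" if "newton_solution M.F (- \<xi>) R u" for R u
    using newton_solution_uminus[OF that] pucci_force_uminus[where g = g, OF g2] by simp
  consider (rest) "ereal \<bar>\<xi>\<bar> = \<alpha> \<or> \<xi> = 0" | (outside_right) "\<alpha> < ereal \<xi>"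
    | (outside_left) "\<alpha> < ereal (- \<xi>)" | (inside_right) "0 < \<xi>" "ereal \<xi> < \<alpha>"
    | (inside_left) "- \<alpha> < ereal \<xi>" "\<xi> < 0"
    using \<alpha>_pos
    by (cases \<alpha>; cases \<xi> "0 :: real" rule: linorder_cases;
        cases \<alpha> "ereal \<bar>\<xi>\<bar>" rule: linorder_cases; simp)
  then show ?thesis
  proof cases
    case rest
    then show ?thesis
      using maximal_if_global[OF sol[OF P.constant_solution[OF rest]]] rest \<alpha>_pos
      by (intro exI[of _ \<infinity>] exI[of _ "\<lambda>_. \<xi>"]) (cases \<alpha>; auto)
  next
    case outside_right
    then have \<xi>: "0 < \<xi>" using \<alpha>_pos by (cases \<alpha>) auto
    obtain R u where u: "newton_solution P.F \<xi> R u" "strictly_increases_to_infinity R u"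
      "\<And>r. r \<in> half_open_ivl R \<Longrightarrow> \<xi> \<le> u r"
      using P.escape[OF P.escape_from_outside[OF outside_right]] by blast
    have inc: "strictly_increases_to_infinity R (\<lambda>r. \<bar>u r\<bar>)"
      using u(2) by (rule strictly_increases_to_infinity_abs) (use u(3) \<xi> in force)
    then have "is_maximal_solution lam Lam g \<xi> R u"
      by (intro maximal_if_blow_up sol u(1)) (simp add: strictly_increases_to_infinity_def comp_def)
    then show ?thesis
      using inc outside_right \<xi> \<alpha>_pos by (intro exI[of _ R] exI[of _ u]) (cases \<alpha>; auto)
  next
    case outside_left
    then have \<xi>: "\<xi> < 0" using \<alpha>_pos by (cases \<alpha>) auto
    obtain R u where u: "newton_solution M.F (- \<xi>) R u" "strictly_increases_to_infinity R u"
      "\<And>r. r \<in> half_open_ivl R \<Longrightarrow> - \<xi> \<le> u r"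
      using M.escape[OF M.escape_from_outside[OF outside_left]] by blast
    have inc: "strictly_increases_to_infinity R (\<lambda>r. \<bar>- u r\<bar>)"
      unfolding abs_minus_cancel
      using u(2) by (rule strictly_increases_to_infinity_abs) (use u(3) \<xi> in force)
    then have "is_maximal_solution lam Lam g \<xi> R (\<lambda>r. - u r)"
      by (intro maximal_if_blow_up sol mirror u(1)) (simp add: strictly_increases_to_infinity_def comp_def)
    then show ?thesis
      using inc outside_left \<xi> \<alpha>_pos by (intro exI[of _ R] exI[of _ "\<lambda>r. - u r"]) (cases \<alpha>; auto)
  next
    case inside_right
    have sub: "ereal (lam * M.G (- \<xi>)) < ereal Lam * primitive_at g \<alpha>"
    proof -
      have pos: "0 < M.G \<xi>" using M.G_less[of 0 \<xi>] inside_right by simp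
      have less: "ereal (M.G \<xi>) < primitive_at g \<alpha>"
        using inside_right by (intro M.G_less_primitive_at) auto
      show ?thesis
      proof (cases rule: M.primitive_at_cases)
        case (1 S)
        then have "M.G \<xi> < S" using less by simp
        then have "lam * M.G \<xi> < lam * S" using assms(1) by simp
        also have "\<dots> \<le> Lam * S" using assms(2) 1(2) by (intro mult_right_mono) auto
        finally show ?thesis using 1 by (simp add: M.G_even)
      qed (use Lam in auto)
    qed
    have start: "- \<alpha> < ereal (- \<xi>)" "- \<xi> < 0" using inside_right by (cases \<alpha>; auto)+
    obtain u b \<tau> where u: "newton_solution M.F (- \<xi>) \<infinity> u" "periodic u" "oscillating u"
      "continuous_on UNIV u" "\<And>r. - \<xi> \<le> u r" "\<And>r. u r \<le> b" "u 0 = - \<xi>"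
      "0 < \<tau>" "u \<tau> = b" "\<And>r. 0 \<le> r \<Longrightarrow> r < \<tau> \<Longrightarrow> u r < b"
      "0 < b" "ereal b < \<alpha>" "Lam * M.G b = lam * M.G (- \<xi>)"
      by (rule M.rebound_solution[OF start sub]) (rule that)
    \<comment> \<open>\<open>b\<close> is the depth of the trough of \<open>- u\<close>. From \<open>Lam * G b = lam * G \<xi>\<close> and
      \<open>lam \<le> Lam\<close> it is at most the height \<open>\<xi>\<close> of the crest.\<close>
    have "b \<le> \<xi>"
    proof (rule ccontr)
      assume "\<not> b \<le> \<xi>"
      then have "M.G \<xi> < M.G b" using inside_right u(12) by (intro M.G_less) auto
      moreover have "0 < M.G \<xi>" using M.G_less[of 0 \<xi>] inside_right by simp
      ultimately have "lam * M.G \<xi> < Lam * M.G b"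
        using assms(1,2) by (intro mult_le_less_imp_less) auto
      then show False using u(13) by (simp add: M.G_even)
    qed
    then have "\<bar>- u r\<bar> \<le> \<xi>" for r using u(5,6)[of r] by auto
    then have "Linf_norm (\<lambda>r. - u r) = ereal \<xi>"
      using u(7) inside_right continuous_on_subset[OF u(4)]
      by (intro Linf_norm_eq_max[where s = 0] continuous_on_minus) auto
    moreover have "is_maximal_solution lam Lam g \<xi> \<infinity> (\<lambda>r. - u r)"
      by (intro maximal_if_global sol mirror u(1))
    moreover have "periodic (\<lambda>r. - u r)" "oscillating (\<lambda>r. - u r)"
      using u(2,3) by (auto simp: periodic_def oscillating_def)
    ultimately show ?thesis
      using inside_right \<alpha>_pos by (intro exI[of _ \<infinity>] exI[of _ "\<lambda>r. - u r"]) (cases \<alpha>; auto)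
  next
    case inside_left
    consider (sub) "ereal (Lam * P.G \<xi>) < ereal lam * primitive_at g \<alpha>"
      | (threshold) "ereal (Lam * P.G \<xi>) = ereal lam * primitive_at g \<alpha>"
      | (super) "ereal lam * primitive_at g \<alpha> < ereal (Lam * P.G \<xi>)"
      by (rule linorder_cases)
    then show ?thesis
    proof cases
      case sub
      obtain u b \<tau> where u: "newton_solution P.F \<xi> \<infinity> u" "periodic u" "oscillating u"
        "continuous_on UNIV u" "\<And>r. \<xi> \<le> u r" "\<And>r. u r \<le> b" "u 0 = \<xi>"
        "0 < \<tau>" "u \<tau> = b" "\<And>r. 0 \<le> r \<Longrightarrow> r < \<tau> \<Longrightarrow> u r < b"
        "0 < b" "ereal b < \<alpha>" "lam * P.G b = Lam * P.G \<xi>"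
        by (rule P.rebound_solution[OF inside_left sub]) (rule that)
      \<comment> \<open>Conversely, a start in the trough gives \<open>lam * G b = Lam * G \<xi>\<close>, so the crest is the
        larger one.\<close>
      have "- \<xi> \<le> b"
      proof (rule ccontr)
        assume "\<not> - \<xi> \<le> b"
        moreover have "ereal (- \<xi>) \<le> \<alpha>" using inside_left(1) by (cases \<alpha>) auto
        ultimately have "P.G b < P.G (- \<xi>)" using u(11) by (intro P.G_less) auto
        moreover have "0 < P.G b" using P.G_less[of 0 b] u(11,12) by auto
        ultimately have "lam * P.G b < Lam * P.G (- \<xi>)"
          using assms(1,2) by (intro mult_le_less_imp_less) auto
        then show False using u(13) by (simp add: P.G_even)
      qed
      then have "\<bar>u r\<bar> \<le> b" for r using u(5,6)[of r] by auto
      then have "Linf_norm u = ereal (u \<tau>)"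
        using u(8,9,11) continuous_on_subset[OF u(4)]
        by (intro Linf_norm_eq_max[where s = \<tau>]) auto
      moreover have "first_maximizer u \<tau>"
        unfolding first_maximizer_def
      proof (intro conjI allI impI)
        show "is_arg_max u (\<lambda>s. 0 \<le> s) \<tau>"
          using u(6,8,9) by (auto simp: is_arg_max_def not_less)
        fix s assume "is_arg_max u (\<lambda>s. 0 \<le> s) s"
        then have "0 \<le> s" "\<not> u s < u \<tau>" using u(8) by (auto simp: is_arg_max_def)
        then show "\<tau> \<le> s" using u(9) u(10)[of s] by force
      qed
      moreover have "is_maximal_solution lam Lam g \<xi> \<infinity> u"
        by (intro maximal_if_global sol u(1))
      ultimately show ?thesis
        using inside_left sub u(2,3,9,12) \<alpha>_pos
        by (intro exI[of _ \<infinity>] exI[of _ u]) (cases \<alpha>; auto)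
    next
      case threshold
      obtain u where u: "newton_solution P.F \<xi> \<infinity> u" "strict_mono_on {0..} u"
        "\<And>r. 0 \<le> r \<Longrightarrow> \<xi> \<le> u r" "\<And>r. 0 \<le> r \<Longrightarrow> ereal (u r) < \<alpha>"
        "((\<lambda>r. ereal (u r)) \<longlongrightarrow> \<alpha>) at_top"
        by (rule P.threshold_solution[OF inside_left threshold]) (rule that)
      have "- \<alpha> < ereal (u r)" if "0 \<le> r" for r
        using inside_left(1) u(3)[OF that] less_le_trans[of "- \<alpha>" "ereal \<xi>" "ereal (u r)"] by simp
      moreover have "is_maximal_solution lam Lam g \<xi> \<infinity> u"
        by (intro maximal_if_global sol u(1))
      ultimately show ?thesis
        using inside_left threshold u \<alpha>_pos
        by (intro exI[of _ \<infinity>] exI[of _ u]) (cases \<alpha>; auto)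
    next
      case super
      obtain R u where u: "newton_solution P.F \<xi> R u" "strictly_increases_to_infinity R u"
        using P.escape[OF P.escape_over_barrier[OF inside_left super]] by blast
      have "filterlim (\<lambda>r. \<bar>u (real_of_ereal r)\<bar>) at_top (at_left R)"
        using u(2) unfolding strictly_increases_to_infinity_def comp_def
        by (auto elim!: filterlim_at_top_mono intro!: always_eventually)
      then have "is_maximal_solution lam Lam g \<xi> R u"
        by (intro maximal_if_blow_up sol u(1))
      then show ?thesis
        using inside_left super u(2) \<alpha>_pos
        by (intro exI[of _ R] exI[of _ u]) (cases \<alpha>; auto)
    qed
  qed
qed

end
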